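(* Let $k\geq 1$ and $n\geq 7k^{2}$ be integers, and let $G$ be a graph of order $n$. (i) If $q(G)\geq q(S_{n,k})$, then $G$ contains $P_{2k+2}$ as a subgraph, unless $G=S_{n,k}$. (ii) If $q(G)\geq q(S_{n,k}^{+})$, then $G$ contains $P_{2k+3}$ as a subgraph, unless $G=S_{n,k}^{+}$.
   Context: All graphs are finite and simple. For a graph $G$, the signless Laplacian is $Q(G)=D(G)+A(G)$, where $D(G)$ is the diagonal matrix of vertex degrees and $A(G)$ is the adjacency matrix; $q(G)$ (the $Q$-index) denotes the largest eigenvalue of $Q(G)$. $P_l$ denotes the path on $l$ vertices. $S_{n,k}=K_k\vee \overline{K}_{n-k}$ is the join of a complete graph of order $k$ and an independent set of order $n-k$ (every vertex of $K_k$ adjacent to every vertex of the independent set). $S_{n,k}^{+}$ is the graph obtained from $S_{n,k}$ by adding one edge (necessarily inside the independent set). Equalities of graphs are up to isomorphism, and "contains as a subgraph" means contains a subgraph isomorphic to it. *)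

theory Defs
  imports
    "Jordan_Normal_Form.Spectral_Radius"
    "Graph_Theory.Graph_Theory"
    "HOL-Library.Countable_Set"
begin

text \<open>A finite simple graph is a \<^locale>\<open>pair_graph\<close>: finite, loop-free, with a symmetric arc
  relation. Each edge is the pair of its two opposite arcs, so the degree of a vertex is its
  \<^const>\<open>out_degree\<close>.\<close>

text \<open>For a finite set, \<^const>\<open>from_nat_into\<close> enumerates it bijectively by the numbers below its
  cardinality. Another enumeration conjugates the matrix by a permutation matrix, so the spectrum
  does not depend on the choice.\<close>

definition signless_laplacian :: "'a pair_pre_digraph \<Rightarrow> real mat" where
  "signless_laplacian G =
     (let n = card (pverts G); v = from_nat_into (pverts G);
          D = mat n n (\<lambda>(i, j). if i = j then real (out_degree (with_proj G) (v i)) else 0);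
          A = mat n n (\<lambda>(i, j). if (v i, v j) \<in> parcs G then 1 else 0)
      in D + A)"

definition Q_index :: "'a pair_pre_digraph \<Rightarrow> real" where
  "Q_index G = Max (spectrum (signless_laplacian G))"

definition graph_iso :: "'a pair_pre_digraph \<Rightarrow> 'b pair_pre_digraph \<Rightarrow> bool" where
  "graph_iso G H \<longleftrightarrow> digraph_iso (with_proj G) (with_proj H)"

definition contains_subgraph :: "'a pair_pre_digraph \<Rightarrow> 'b pair_pre_digraph \<Rightarrow> bool" where
  "contains_subgraph G F \<longleftrightarrow>
     (\<exists>H. pair_graph H \<and> subgraph (with_proj H) (with_proj G) \<and> graph_iso H F)"

definition complete_graph_on :: "'a set \<Rightarrow> 'a pair_pre_digraph" where
  "complete_graph_on V = \<lparr> pverts = V, parcs = {(u, v). u \<in> V \<and> v \<in> V \<and> u \<noteq> v} \<rparr>"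

definition edgeless_graph_on :: "'a set \<Rightarrow> 'a pair_pre_digraph" where
  "edgeless_graph_on V = \<lparr> pverts = V, parcs = {} \<rparr>"

text \<open>The join; only meaningful for graphs with disjoint vertex sets.\<close>

definition graph_join ::
    "'a pair_pre_digraph \<Rightarrow> 'a pair_pre_digraph \<Rightarrow> 'a pair_pre_digraph" where
  "graph_join G H =
     \<lparr> pverts = pverts G \<union> pverts H,
       parcs = parcs G \<union> parcs H \<union> pverts G \<times> pverts H \<union> pverts H \<times> pverts G \<rparr>"

definition add_edge :: "'a \<Rightarrow> 'a \<Rightarrow> 'a pair_pre_digraph \<Rightarrow> 'a pair_pre_digraph" where
  "add_edge u v G = \<lparr> pverts = pverts G, parcs = parcs G \<union> {(u, v), (v, u)} \<rparr>"

definition S_graph :: "nat \<Rightarrow> nat \<Rightarrow> nat pair_pre_digraph" where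
  "S_graph n k = graph_join (complete_graph_on {0..<k}) (edgeless_graph_on {k..<n})"

text \<open>Up to isomorphism it does not matter which two vertices of the independent set
  \<open>{k..<n}\<close> are joined. Only meaningful for \<open>k + 2 \<le> n\<close>.\<close>

definition S_plus_graph :: "nat \<Rightarrow> nat \<Rightarrow> nat pair_pre_digraph" where
  "S_plus_graph n k = add_edge k (k + 1) (S_graph n k)"

definition path_graph :: "nat \<Rightarrow> nat pair_pre_digraph" where
  "path_graph l =
     \<lparr> pverts = {0..<l}, parcs = {(i, j). i < l \<and> j < l \<and> (j = i + 1 \<or> i = j + 1)} \<rparr>"

end

theory Submission
  imports Defs
begin

text \<open>The absolute value \<open>y\<close> of an eigenvector for \<open>\<mu> = q(G)\<close> satisfies \<open>\<mu> y \<le> Q y\<close>.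
  Call a vertex a hub if twice its degree is at least \<open>n + 2 k + 1\<close>. Any two hubs have
  \<open>2 k + 1\<close> common neighbours, so hubs can be chained greedily into a path, and \<open>k + 1\<close> hubs
  would give a path on \<open>2 k + 3\<close> vertices. If there were fewer than \<open>k\<close> hubs, then by the Erdos-Gallai
  bound \<open>y\<close> would be less than \<open>2/7\<close> of its maximum off the hubs, and the inequality at a
  maximal vertex would contradict \<open>\<mu> \<ge> n + 2 k - 16/7\<close>. So there are exactly \<open>k\<close> hubs, and
  excluding long paths leaves only isolated vertices, stars and single edges attached to them.
  For these graphs there is a positive weight \<open>w\<close> with \<open>Q w \<le> \<theta> w\<close>, where \<open>\<theta>\<close> is the Q-index of
  the extremal graph. Pairing \<open>w\<close> with \<open>y\<close> gives \<open>\<mu> = \<theta>\<close> and equality at every hub, which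
  makes each hub adjacent to all other vertices and determines the graph.\<close>

section \<open>Paths and the Erdos-Gallai bound\<close>

text \<open>The comparison values \<theta> are roots of one scalar equation, the eigenvalue equation
  of the extremal graph at a clique vertex after the remaining values have been eliminated; the
  spectra of \<open>S_graph\<close> and \<open>S_plus_graph\<close> enter only through these roots.
  The constants leave almost no room. In the bound \<theta> \<ge> n + 2k - 16/7 the number is 2 +
  2/7, and n \<ge> 7k^2 makes the 2/7 pay for a term 2k^2; conversely, y < 2/7 off the hubs together
  with k - 1 hubs gives exactly \<mu> < n + 2k - 16/7. The 2/7 estimate breaks down for k = 1, where
  the absence of a path on five vertices is used directly. Two obstacles shape the comparison.
  Nothing makes \<open>G\<close> connected, so \<open>y\<close> may vanish somewhere, and equality
  for \<open>w\<close> is available only where it does not. And several single edges may hang on the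
  hubs, more than the one extra edge of \<open>S_plus_graph\<close> pays for; they must then all
  hang on a single hub, where the smaller root belonging to \<open>S_graph\<close> already
  suffices.\<close>

locale simple_graph =
  fixes V :: "'a set" and E :: "('a \<times> 'a) set"
  assumes finite_V: "finite V"
    and E_subset: "E \<subseteq> V \<times> V"
    and E_sym: "(u, v) \<in> E \<Longrightarrow> (v, u) \<in> E"
    and E_irrefl: "(v, v) \<notin> E"
begin

definition nbs :: "'a \<Rightarrow> 'a set" where "nbs v = {w. (v, w) \<in> E}"

definition deg :: "'a \<Rightarrow> nat" where "deg v = card (nbs v)"

text \<open>Ordered pairs are counted, so \<open>arcs_btw X X\<close> is twice the number of edges
  inside \<open>X\<close>; the Erdos-Gallai bound is stated in this form, without the factor
  1/2.\<close>

definition arcs_btw :: "'a set \<Rightarrow> 'a set \<Rightarrow> nat" where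
  "arcs_btw A B = (\<Sum>a\<in>A. card (nbs a \<inter> B))"

definition path :: "'a list \<Rightarrow> bool" where
  "path p \<longleftrightarrow> distinct p \<and> set p \<subseteq> V \<and> successively (\<lambda>x y. (x, y) \<in> E) p"

lemma nbs_iff: "w \<in> nbs v \<longleftrightarrow> (v, w) \<in> E"
  by (simp add: nbs_def)

lemma nbs_commute: "w \<in> nbs v \<longleftrightarrow> v \<in> nbs w"
  using E_sym by (auto simp: nbs_iff)

lemma nbs_subset: "nbs v \<subseteq> V"
  using E_subset by (auto simp: nbs_iff)

lemma nbs_in_V: "w \<in> nbs v \<Longrightarrow> v \<in> V" "w \<in> nbs v \<Longrightarrow> w \<in> V"
  using E_subset by (auto simp: nbs_iff)

lemma not_in_nbs [simp]: "v \<notin> nbs v"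
  by (simp add: nbs_iff E_irrefl)

lemma finite_nbs [simp]: "finite (nbs v)"
  using finite_subset[OF nbs_subset finite_V] .

lemma deg_less: "v \<in> V \<Longrightarrow> deg v < card V"
  unfolding deg_def by (rule psubset_card_mono[OF finite_V]) (use nbs_subset not_in_nbs in blast)

lemma arcs_btw_card:
  assumes "finite A" "finite B"
  shows "arcs_btw A B = card (E \<inter> A \<times> B)"
proof -
  have "E \<inter> A \<times> B = (SIGMA a:A. nbs a \<inter> B)"
    by (auto simp: nbs_iff)
  then show ?thesis
    using assms by (simp add: arcs_btw_def)
qed

lemma arcs_btw_commute:
  assumes "finite A" "finite B"
  shows "arcs_btw A B = arcs_btw B A"
proof -
  have "E \<inter> B \<times> A = prod.swap ` (E \<inter> A \<times> B)"
    using E_sym by auto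
  then show ?thesis
    using assms by (simp add: arcs_btw_card card_image)
qed

lemma arcs_btw_Un_left:
  assumes "finite A" "finite B" "A \<inter> B = {}"
  shows "arcs_btw (A \<union> B) C = arcs_btw A C + arcs_btw B C"
  using assms by (simp add: arcs_btw_def sum.union_disjoint)

lemma arcs_btw_Un_right:
  assumes "finite A" "finite B" "A \<inter> B = {}"
  shows "arcs_btw C (A \<union> B) = arcs_btw C A + arcs_btw C B"
proof -
  have "card (nbs c \<inter> (A \<union> B)) = card (nbs c \<inter> A) + card (nbs c \<inter> B)" for c
    unfolding Int_Un_distrib using assms by (subst card_Un_disjoint) auto
  then show ?thesis
    by (simp add: arcs_btw_def sum.distrib)
qed

lemma arcs_btw_le_mult: "finite A \<Longrightarrow> finite B \<Longrightarrow> arcs_btw A B \<le> card A * card B"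
  unfolding arcs_btw_def by (rule sum_bounded_above[of A "\<lambda>a. card (nbs a \<inter> B)" "card B", simplified])
    (simp add: card_mono)

section \<open>Paths as lists of vertices\<close>

lemma path_Nil [simp]: "path []"
  by (simp add: path_def)

lemma path_single [simp]: "path [v] \<longleftrightarrow> v \<in> V"
  by (simp add: path_def)

lemma path_Cons:
  "path (v # p) \<longleftrightarrow> v \<in> V \<and> v \<notin> set p \<and> path p \<and> (p = [] \<or> hd p \<in> nbs v)"
  by (cases p) (auto simp: path_def nbs_iff)

lemma path_append:
  "path (p @ q) \<longleftrightarrow> path p \<and> path q \<and> set p \<inter> set q = {} \<and> (p = [] \<or> q = [] \<or> hd q \<in> nbs (last p))"
  by (auto simp: path_def successively_append_iff nbs_iff)

lemma path_rev: "path (rev p) \<longleftrightarrow> path p"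
proof -
  have "successively (\<lambda>x y. (y, x) \<in> E) p = successively (\<lambda>x y. (x, y) \<in> E) p"
    by (rule successively_cong) (auto dest: E_sym)
  then show ?thesis
    unfolding path_def successively_rev by simp
qed

text \<open>The edge from the last vertex back to the head closes the path up, so every vertex on it
  can be made the head.\<close>

lemma path_rotate:
  assumes "path p" "p \<noteq> []" "hd p \<in> nbs (last p)"
  shows "path (rotate m p) \<and> hd (rotate m p) \<in> nbs (last (rotate m p))"
proof (induction m)
  case 0
  then show ?case using assms by simp
next
  case (Suc m)
  obtain x xs where eq: "rotate m p = x # xs"
    using assms(2) by (metis list.exhaust rotate_is_Nil_conv)
  show ?case
  proof (cases "xs = []")
    case True
    then show ?thesis using Suc eq by simp
  next
    case False
    then show ?thesis
      using Suc eq by (auto simp: path_append path_Cons)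
  qed
qed

lemma path_length: "path p \<Longrightarrow> set p \<subseteq> X \<Longrightarrow> finite X \<Longrightarrow> length p \<le> card X"
  by (metis card_mono distinct_card path_def)

lemma path_take: "path p \<Longrightarrow> path (take m p)"
  using path_append[of "take m p" "drop m p"] by simp

text \<open>Posa's crossing argument closes a longest path whose end vertices have large degree into
  a cycle, and no edge leaves the vertex set of this cycle.\<close>

lemma closed_component:
  fixes j :: nat
  assumes fin: "finite X" and sub: "X \<subseteq> V" and ne: "X \<noteq> {}"
    and no_path: "\<And>p. path p \<Longrightarrow> set p \<subseteq> X \<Longrightarrow> length p \<noteq> 2 * j + 3"
    and min_deg: "\<And>x. x \<in> X \<Longrightarrow> card (nbs x \<inter> X) > j"
  obtains C where "C \<noteq> {}" "C \<subseteq> X" "card C \<le> 2 * j + 2" "\<forall>c\<in>C. nbs c \<inter> X \<subseteq> C"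
proof -
  define P where "P p \<longleftrightarrow> path p \<and> set p \<subseteq> X \<and> p \<noteq> []" for p
  obtain x0 where "x0 \<in> X" using ne by auto
  then have "P [x0]" using sub by (auto simp: P_def)
  moreover have "\<forall>p. P p \<longrightarrow> length p < Suc (card X)"
    using path_length[OF _ _ fin] by (auto simp: P_def less_Suc_eq_le)
  ultimately obtain p where p: "P p" and max: "\<And>q. P q \<Longrightarrow> length q \<le> length p"
    using ex_has_greatest_nat[of P "[x0]" length "Suc (card X)"] by blast
  have pp: "path p" "set p \<subseteq> X" "p \<noteq> []" "distinct p"
    using p by (auto simp: P_def path_def)
  define t where "t = length p"
  have t_le: "t \<le> 2 * j + 2"
  proof (rule ccontr)
    assume "\<not> ?thesis"
    then have "length (take (2 * j + 3) p) = 2 * j + 3" by (simp add: t_def)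
    moreover have "path (take (2 * j + 3) p)" "set (take (2 * j + 3) p) \<subseteq> X"
      using pp path_take set_take_subset[of "2 * j + 3" p] by blast+
    ultimately show False using no_path by blast
  qed
  have t_pos: "t > 0" using pp by (simp add: t_def)
  \<comment> \<open>Stated for every reordering \<open>q\<close> of the vertices of
    \<open>p\<close>, because maximality concerns only the length: a neighbour of the head outside
    \<open>q\<close> could be prepended.\<close>
  have extend: "nbs (hd q) \<inter> X \<subseteq> set q" if q: "path q" "set q = set p" "length q = t" for q
  proof
    fix z assume z: "z \<in> nbs (hd q) \<inter> X"
    show "z \<in> set q"
    proof (rule ccontr)
      assume "z \<notin> set q"
      then have "P (z # q)"
        using z q pp sub by (auto simp: P_def path_Cons nbs_commute)
      then show False using max q(3) t_def by fastforce
    qed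
  qed
  \<comment> \<open>Both sets index edges of the path: those whose second end is adjacent to the
    head, and those whose first end is adjacent to the last vertex. A common index is a
    crossing.\<close>
  define S where "S = {i. i < t - 1 \<and> p ! Suc i \<in> nbs (p ! 0)}"
  define T where "T = {i. i < t - 1 \<and> p ! i \<in> nbs (p ! (t - 1))}"
  have hd_in: "p ! 0 \<in> X" and last_in: "p ! (t - 1) \<in> X"
    using pp t_pos by (auto simp: t_def)
  have "nbs (p ! 0) \<inter> X \<subseteq> (\<lambda>i. p ! Suc i) ` S"
  proof
    fix z assume z: "z \<in> nbs (p ! 0) \<inter> X"
    then have "z \<in> set p" using extend[of p] pp by (auto simp: t_def hd_conv_nth)
    then obtain i where i: "i < t" "z = p ! i" by (auto simp: in_set_conv_nth t_def)
    moreover have "i \<noteq> 0" using z i by (metis IntD1 not_in_nbs)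
    ultimately show "z \<in> (\<lambda>i. p ! Suc i) ` S"
      using z by (intro image_eqI[of _ _ "i - 1"]) (auto simp: S_def)
  qed
  then have "card (nbs (p ! 0) \<inter> X) \<le> card S"
    by (rule surj_card_le[rotated]) (simp add: S_def)
  then have S: "card S > j" using min_deg[OF hd_in] by simp
  have "nbs (p ! (t - 1)) \<inter> X \<subseteq> (\<lambda>i. p ! i) ` T"
  proof
    fix z assume z: "z \<in> nbs (p ! (t - 1)) \<inter> X"
    then have "z \<in> set p"
      using extend[of "rev p"] pp by (auto simp: path_rev t_def hd_rev last_conv_nth)
    then obtain i where i: "i < t" "z = p ! i" by (auto simp: in_set_conv_nth t_def)
    moreover have "i \<noteq> t - 1" using z i by (metis IntD1 not_in_nbs)
    ultimately show "z \<in> (\<lambda>i. p ! i) ` T"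
      using z by (intro image_eqI[of _ _ i]) (auto simp: T_def)
  qed
  then have "card (nbs (p ! (t - 1)) \<inter> X) \<le> card T"
    by (rule surj_card_le[rotated]) (simp add: T_def)
  then have T: "card T > j" using min_deg[OF last_in] by simp
  \<comment> \<open>There are only \<open>t - 1 \<le> 2 * j + 1\<close> indices, while each set has
    at least \<open>j + 1\<close>.\<close>
  have "S \<inter> T \<noteq> {}"
  proof
    assume "S \<inter> T = {}"
    then have "card S + card T = card (S \<union> T)"
      by (simp add: card_Un_disjoint S_def T_def)
    also have "\<dots> \<le> card {..<t - 1}"
      by (rule card_mono) (auto simp: S_def T_def)
    finally show False using S T t_le by simp
  qed
  then obtain i where i: "i < t - 1" "p ! Suc i \<in> nbs (p ! 0)" "p ! i \<in> nbs (p ! (t - 1))"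
    by (auto simp: S_def T_def)
  \<comment> \<open>The cycle drops the edge at position \<open>i\<close>: it runs from
    \<open>p ! Suc i\<close> to the end of \<open>p\<close>, jumps to \<open>p ! i\<close>, returns
    to the start, and closes with the edge from \<open>p ! 0\<close> to
    \<open>p ! Suc i\<close>.\<close>
  define q where "q = drop (Suc i) p @ rev (take (Suc i) p)"
  have decomp: "path (take (Suc i) p @ drop (Suc i) p)" using pp by simp
  have ne': "drop (Suc i) p \<noteq> []" "take (Suc i) p \<noteq> []" using i pp by (auto simp: t_def)
  have "last (take (Suc i) p) = p ! i"
    using i by (subst take_Suc_conv_app_nth) (auto simp: t_def)
  moreover have "last (drop (Suc i) p) = p ! (t - 1)"
    using i pp by (subst last_drop) (simp_all add: t_def last_conv_nth)
  moreover have "hd (take (Suc i) p) = p ! 0"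
    using pp by (simp add: hd_conv_nth)
  moreover have "hd (drop (Suc i) p) = p ! Suc i"
    using i by (simp add: t_def hd_drop_conv_nth)
  ultimately have q: "path q" "hd q \<in> nbs (last q)"
    using decomp ne' i unfolding q_def path_append
    by (auto simp: path_rev hd_rev last_rev)
  have q_set: "set q = set p" unfolding q_def by (metis append_take_drop_id inf_sup_aci(5) set_append set_rev)
  have q_len: "length q = t" using i by (simp add: q_def t_def)
  have q_ne: "q \<noteq> []" using q_len t_pos by auto
  have closed: "nbs c \<inter> X \<subseteq> set p" if c: "c \<in> set p" for c
  proof -
    obtain m where m: "m < length q" "q ! m = c"
      using c q_set by (metis in_set_conv_nth)
    have "hd (rotate m q) = c"
      using m q_ne by (simp add: hd_rotate_conv_nth)
    moreover have "path (rotate m q)" using path_rotate[OF q(1) q_ne q(2)] by blast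
    ultimately show ?thesis
      using extend[of "rotate m q"] q_set q_len by simp
  qed
  show thesis
  proof (rule that[of "set p"])
    show "card (set p) \<le> 2 * j + 2" using t_le pp by (simp add: t_def distinct_card)
  qed (use pp closed in auto)
qed

text \<open>Induction by deletion. A vertex with at most \<open>j\<close> neighbours in
  \<open>X\<close> costs at most \<open>2 * j\<close> arcs. If there is none,
  \<open>closed_component\<close> splits off a set with no edges to the rest and at most
  \<open>2 * j + 2\<close> vertices, so that each of them has at most \<open>2 * j + 1\<close>
  neighbours.\<close>

lemma Erdos_Gallai:
  assumes "finite X" "X \<subseteq> V"
    and "\<And>p. path p \<Longrightarrow> set p \<subseteq> X \<Longrightarrow> length p \<noteq> 2 * j + 3"
  shows "arcs_btw X X \<le> (2 * j + 1) * card X"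
  using assms
proof (induction X rule: finite_psubset_induct)
  case (psubset X)
  have split: "arcs_btw X X = arcs_btw (X - C) (X - C) + arcs_btw C C + 2 * arcs_btw C (X - C)"
    if "C \<subseteq> X" for C
  proof -
    have fin: "finite C" "finite (X - C)" using that psubset.hyps finite_subset by auto
    have X: "X = (X - C) \<union> C" using that by auto
    have disj: "(X - C) \<inter> C = {}" by auto
    have "arcs_btw X X = arcs_btw ((X - C) \<union> C) ((X - C) \<union> C)" using X by simp
    also have "\<dots> = arcs_btw (X - C) (X - C) + arcs_btw (X - C) C + (arcs_btw C (X - C) + arcs_btw C C)"
      using fin disj by (simp only: arcs_btw_Un_left arcs_btw_Un_right)
    finally show ?thesis
      using arcs_btw_commute[OF fin] by simp
  qed
  have IH: "arcs_btw (X - C) (X - C) \<le> (2 * j + 1) * card (X - C)" if "C \<subseteq> X" "C \<noteq> {}" for C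
    using psubset.IH[of "X - C"] psubset.prems that by blast
  consider "X = {}" | x where "x \<in> X" "card (nbs x \<inter> X) \<le> j"
    | "X \<noteq> {}" "\<And>x. x \<in> X \<Longrightarrow> card (nbs x \<inter> X) > j"
    using not_le by blast
  then show ?case
  proof cases
    case 1
    then show ?thesis by (simp add: arcs_btw_def)
  next
    case 2
    have "card (nbs x \<inter> (X - {x})) \<le> card (nbs x \<inter> X)"
      by (rule card_mono) auto
    then have "arcs_btw {x} (X - {x}) \<le> j"
      using 2(2) by (simp add: arcs_btw_def)
    moreover have "arcs_btw {x} {x} = 0" by (simp add: arcs_btw_def)
    moreover have "card X = Suc (card (X - {x}))"
      using 2 psubset.hyps by (metis card.remove)
    ultimately show ?thesis
      using split[of "{x}"] IH[of "{x}"] 2(1) by (simp add: distrib_left del: card_Diff_insert)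
  next
    case 3
    obtain C where C: "C \<noteq> {}" "C \<subseteq> X" "card C \<le> 2 * j + 2" "\<forall>c\<in>C. nbs c \<inter> X \<subseteq> C"
      by (rule closed_component[OF psubset.hyps psubset.prems(1) 3(1) psubset.prems(2) 3(2)])
    have finC: "finite C" using C(2) psubset.hyps finite_subset by blast
    have "arcs_btw C (X - C) = 0"
    proof -
      have "nbs c \<inter> (X - C) = {}" if "c \<in> C" for c
        using C(4) that by blast
      then show ?thesis by (simp add: arcs_btw_def)
    qed
    moreover have "arcs_btw C C \<le> (2 * j + 1) * card C"
    proof -
      have "card (nbs c \<inter> C) \<le> 2 * j + 1" if "c \<in> C" for c
      proof -
        have "card (nbs c \<inter> C) < card C"
          by (rule psubset_card_mono[OF finC]) (use that not_in_nbs in blast)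
        then show ?thesis using C(3) by simp
      qed
      then show ?thesis
        unfolding arcs_btw_def using sum_bounded_above[of C "\<lambda>c. card (nbs c \<inter> C)" "2 * j + 1"]
        by (simp only: mult.commute of_nat_id)
    qed
    moreover have "card X = card (X - C) + card C"
      using C(2) psubset.hyps finC by (metis card_Diff_subset card_mono le_add_diff_inverse2)
    ultimately show ?thesis
      using split[OF C(2)] IH[OF C(2,1)] by (simp add: distrib_left)
  qed
qed

end

section \<open>Vertices of large degree\<close>

locale hub_graph = simple_graph +
  fixes k :: nat
begin

definition hubs :: "'a set" where
  "hubs = {v \<in> V. card V + 2 * k + 1 \<le> 2 * deg v}"

lemma hubs_subset: "hubs \<subseteq> V"
  by (auto simp: hubs_def)

lemma finite_hubs [simp]: "finite hubs"
  using finite_subset[OF hubs_subset finite_V] .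

lemma hub_deg: "h \<in> hubs \<Longrightarrow> card V + 2 * k + 1 \<le> 2 * deg h"
  by (simp add: hubs_def)

lemma card_common_nbs:
  assumes "h \<in> hubs" "h' \<in> hubs"
  shows "2 * k + 1 \<le> card (nbs h \<inter> nbs h')"
proof -
  have "card (nbs h \<union> nbs h') \<le> card V"
    using nbs_subset by (intro card_mono finite_V) auto
  moreover have "deg h + deg h' = card (nbs h \<union> nbs h') + card (nbs h \<inter> nbs h')"
    unfolding deg_def by (rule card_Un_Int) auto
  ultimately show ?thesis
    using hub_deg[OF assms(1)] hub_deg[OF assms(2)] by linarith
qed

lemma hub_end:
  assumes "path p" "p \<noteq> []" "last p \<in> hubs" "length p \<le> 2 * k + 2"
  obtains x where "path (p @ [x])"
proof -
  have h: "last p \<in> V" using assms(3) hubs_subset by auto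
  have "card (set p - {last p}) < deg (last p)"
  proof -
    have "card (set p - {last p}) < length p"
      using assms(1,2) by (metis card_Diff1_less distinct_card finite_set last_in_set path_def)
    \<comment> \<open>Subtracting \<open>deg < card V\<close> from
      \<open>card V + 2 * k + 1 \<le> 2 * deg\<close> leaves this bound.\<close>
    moreover have "2 * k + 2 \<le> deg (last p)"
      using hub_deg[OF assms(3)] deg_less[OF h] by linarith
    ultimately show ?thesis using assms(4) by linarith
  qed
  then have "\<not> nbs (last p) \<subseteq> set p - {last p}"
    unfolding deg_def by (meson card_mono finite_Diff finite_set not_le)
  then obtain x where x: "x \<in> nbs (last p)" "x \<notin> set p" by auto
  then have "path (p @ [x])"
    using assms(1,2) nbs_in_V(2)[OF x(1)] by (simp add: path_append)
  then show ?thesis by (rule that)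
qed

text \<open>The hubs are visited in the order of \<open>hs\<close>, each reached through a fresh
  common neighbour, hence two new vertices per hub. Prescribing the order fixes the final hub, and
  \<open>F\<close> is kept free so that its vertices can be appended afterwards.\<close>

lemma hub_chain:
  assumes "path p" "p \<noteq> []" "last p \<in> hubs" "distinct hs" "set hs \<subseteq> hubs"
    and "set hs \<inter> set p = {}" "finite F" "F \<inter> (set p \<union> set hs) = {}"
    and "length p + 2 * length hs + card F \<le> 2 * k + 3"
  shows "\<exists>q. path (p @ q) \<and> length q = 2 * length hs \<and> set q \<inter> F = {}
    \<and> last (p @ q) = last (last p # hs)"
  using assms
proof (induction hs arbitrary: p)
  case Nil
  then show ?case by (intro exI[of _ "[]"]) auto
next
  case (Cons h hs)
  have h: "h \<in> hubs" "h \<in> V" using Cons.prems hubs_subset by auto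
  \<comment> \<open>The connector avoids \<open>last p\<close> and \<open>h\<close> by itself, since
    no vertex is its own neighbour. Leaving them out keeps the size at most \<open>2 * k\<close>,
    below the number of common neighbours.\<close>
  define bad where "bad = (set p - {last p}) \<union> set hs \<union> F"
  have "card bad \<le> card (set p - {last p}) + card (set hs) + card F"
    unfolding bad_def by (meson card_Un_le add_le_mono1 le_trans)
  moreover have "card (set p - {last p}) = length p - 1"
    using Cons.prems(1,2) by (simp add: distinct_card path_def)
  moreover have "card (set hs) = length hs"
    using Cons.prems(4) by (simp add: distinct_card)
  moreover have "length p > 0" using Cons.prems(2) by simp
  ultimately have "card bad < 2 * k + 1"
    using Cons.prems(9) by simp
  then have "card bad < card (nbs (last p) \<inter> nbs h)"
    using card_common_nbs[OF Cons.prems(3) h(1)] by linarith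
  moreover have "finite bad" using Cons.prems(7) by (simp add: bad_def)
  ultimately have "\<not> nbs (last p) \<inter> nbs h \<subseteq> bad"
    by (meson card_mono not_le)
  then obtain x where x: "x \<in> nbs (last p)" "x \<in> nbs h" "x \<notin> bad" by auto
  have x': "x \<notin> set p" "x \<notin> set hs" "x \<notin> F" "x \<noteq> h"
    using x by (auto simp: bad_def)
  define p' where "p' = p @ [x, h]"
  have p': "path p'"
    using Cons.prems(1,2,6) x x' h nbs_in_V(2)[OF x(1)] nbs_commute
    by (auto simp: p'_def path_append path_Cons)
  have "\<exists>q. path (p' @ q) \<and> length q = 2 * length hs \<and> set q \<inter> F = {}
      \<and> last (p' @ q) = last (last p' # hs)"
    by (rule Cons.IH[OF p']) (use Cons.prems x' h in \<open>auto simp: p'_def\<close>)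
  then obtain q where q: "path (p' @ q)" "length q = 2 * length hs" "set q \<inter> F = {}"
      "last (p' @ q) = last (last p' # hs)"
    by blast
  show ?case
    using q x' Cons.prems(8) by (intro exI[of _ "[x, h] @ q"]) (auto simp: p'_def)
qed

text \<open>Each further hub adds itself and a connector, and \<open>hub_end\<close> adds one vertex
  after the last hub. With exactly \<open>k\<close> hubs, a start of three vertices thus yields a
  path on \<open>2 * k + 2\<close> vertices and a start of four yields \<open>2 * k + 3\<close>;
  this is how long paths restrict the graph off the hubs.\<close>

lemma hub_extend:
  assumes "path p" "p \<noteq> []" "set p \<inter> hubs = {last p}" "length p + 2 * card hubs \<le> 2 * k + 4"
  obtains q where "path q" "length q = length p + 2 * card hubs - 1"
proof -
  obtain hs where hs: "set hs = hubs - {last p}" "distinct hs"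
    using finite_distinct_list[of "hubs - {last p}"] by auto
  have last: "last p \<in> hubs" using assms(3) by auto
  then have len: "length hs + 1 = card hubs"
    using hs by (metis Suc_eq_plus1 card.remove distinct_card finite_hubs)
  have "length p + 2 * length hs + card {} \<le> 2 * k + 3"
    using assms(4) len by simp
  moreover have "set hs \<subseteq> hubs" "set hs \<inter> set p = {}"
    using hs(1) assms(3) by auto
  ultimately obtain q where q: "path (p @ q)" "length q = 2 * length hs" "last (p @ q) = last (last p # hs)"
    using hub_chain[OF assms(1,2) last hs(2), of "{}"] by blast
  have "last (last p # hs) \<in> set (last p # hs)"
    by (rule last_in_set) simp
  then have "last (p @ q) \<in> hubs"
    unfolding q(3) using hs(1) last by (metis Diff_iff set_ConsD)
  moreover have "length (p @ q) \<le> 2 * k + 2"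
    using q(2) len assms(4) by simp
  ultimately obtain x where "path ((p @ q) @ [x])"
    using hub_end[OF q(1)] assms(2) by blast
  then show ?thesis
    using that[of "(p @ q) @ [x]"] q(2) len by simp
qed

end

locale no_long_path = hub_graph +
  assumes no_path: "\<And>p. path p \<Longrightarrow> length p \<noteq> 2 * k + 3"
begin

lemma Erdos_Gallai_whole:
  assumes "X \<subseteq> V"
  shows "arcs_btw X X \<le> (2 * k + 1) * card X"
  using Erdos_Gallai[of X k] assms no_path finite_subset[OF assms finite_V] by blast

lemma card_hubs_le: "card hubs \<le> k"
proof (rule ccontr)
  assume "\<not> ?thesis"
  then obtain H where H: "H \<subseteq> hubs" "card H = Suc k"
    by (metis not_less_eq_eq obtain_subset_with_card_n)
  have "finite H" using H(1) finite_subset finite_hubs by blast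
  then obtain hs' where "set hs' = H" "distinct hs'"
    using finite_distinct_list by blast
  moreover from this have "length hs' = Suc k" using H(2) by (metis distinct_card)
  ultimately obtain h hs where hs: "set (h # hs) = H" "distinct (h # hs)" "length hs = k"
    by (metis length_Suc_conv)
  have h: "h \<in> hubs" "h \<in> V" using hs(1) H(1) hubs_subset by auto
  have "card (set hs) < deg h"
    using hub_deg[OF h(1)] deg_less[OF h(2)] hs(2,3) by (simp add: distinct_card)
  then have "\<not> nbs h \<subseteq> set hs"
    unfolding deg_def by (meson card_mono finite_set not_le)
  \<comment> \<open>The path will be \<open>x\<close>, the \<open>k + 1\<close> chosen hubs with
    \<open>k\<close> connectors, and one final vertex. Here \<open>x\<close> need only avoid the
    chosen hubs and may be a hub itself.\<close>
  then obtain x where x: "x \<in> nbs h" "x \<notin> set hs" by blast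
  have "path [x, h]"
    using x h nbs_in_V(2)[OF x(1)] by (auto simp: path_Cons nbs_commute)
  moreover have "last [x, h] \<in> hubs" using h by simp
  moreover have "set hs \<inter> set [x, h] = {}" using x hs(2) by auto
  moreover have "set hs \<subseteq> hubs" using hs(1) H(1) by auto
  ultimately obtain q where q: "path ([x, h] @ q)" "length q = 2 * k" "last ([x, h] @ q) = last (h # hs)"
    using hub_chain[of "[x, h]" hs "{}"] hs(2,3) by auto
  have "last (h # hs) \<in> set (h # hs)"
    by (rule last_in_set) simp
  then have "last ([x, h] @ q) \<in> hubs"
    unfolding q(3) using hs(1) H(1) by blast
  then obtain y where "path (([x, h] @ q) @ [y])"
    using hub_end[OF q(1)] q(2) by auto
  then show False using no_path q(2) by fastforce
qed

end

section \<open>Counting the hubs\<close>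

text \<open>The two lower bounds on \<mu> are those that \<open>root_exists\<close> provides; for
  \<open>k = 1\<close> the second improves the first by 2/7.\<close>

locale subeigenvector = no_long_path +
  fixes y :: "'a \<Rightarrow> real" and \<mu> :: real and u :: 'a
  assumes y_nonneg: "v \<in> V \<Longrightarrow> 0 \<le> y v"
    and y_le_1: "v \<in> V \<Longrightarrow> y v \<le> 1"
    and u_in_V: "u \<in> V" and y_u: "y u = 1"
    and subeigen: "v \<in> V \<Longrightarrow> \<mu> * y v \<le> real (deg v) * y v + (\<Sum>w\<in>nbs v. y w)"
    and k_pos: "k \<ge> 1" and card_V: "card V \<ge> 7 * k ^ 2"
    and \<mu>_ge: "\<mu> \<ge> real (card V) + 2 * real k - 16 / 7"
    and \<mu>_ge_1: "k = 1 \<Longrightarrow> \<mu> \<ge> real (card V)"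
begin

abbreviation "R \<equiv> V - hubs"

lemma finite_R [simp]: "finite R"
  using finite_V by simp

lemma card_R: "card R + card hubs = card V"
  using finite_V hubs_subset by (metis card_Diff_subset card_mono finite_hubs le_add_diff_inverse2)

lemma nbs_split: "nbs v = (nbs v \<inter> hubs) \<union> (nbs v \<inter> R)"
  using nbs_subset by auto

lemma deg_split: "deg v = card (nbs v \<inter> hubs) + card (nbs v \<inter> R)"
  unfolding deg_def by (subst nbs_split, rule card_Un_disjoint) auto

lemma sum_nbs_split: "(\<Sum>w\<in>nbs v. f w) = (\<Sum>w\<in>nbs v \<inter> hubs. f w) + (\<Sum>w\<in>nbs v \<inter> R. f w :: real)"
  by (subst nbs_split, rule sum.union_disjoint) auto

lemma card_nbs_hubs_le: "card (nbs v \<inter> hubs) \<le> card hubs"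
  by (rule card_mono) auto

lemma sum_y_le_card: "A \<subseteq> V \<Longrightarrow> (\<Sum>w\<in>A. y w) \<le> real (card A)"
  using sum_bounded_above[of A y 1] y_le_1 by auto

lemma two_deg_u: "\<mu> \<le> 2 * real (deg u)"
  using subeigen[OF u_in_V] sum_y_le_card[OF nbs_subset, of u] y_u by (simp add: deg_def)

text \<open>The degree term is split: its hub part, at most \<open>card hubs * y v\<close>, moves to
  the left, and its remaining part is bounded by \<open>c\<close> just like the neighbour sum,
  whence the factor 2.\<close>

lemma subeigen_R:
  assumes v: "v \<in> R" and c: "\<And>w. w \<in> R \<Longrightarrow> y w \<le> c"
  shows "(\<mu> - real (card hubs)) * y v \<le> real (card (nbs v \<inter> hubs)) + 2 * c * real (card (nbs v \<inter> R))"
proof -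
  define dL where "dL = real (card (nbs v \<inter> hubs))"
  define dR where "dR = real (card (nbs v \<inter> R))"
  have "(\<Sum>w\<in>nbs v \<inter> hubs. y w) \<le> dL"
    unfolding dL_def by (rule sum_y_le_card) (use hubs_subset in auto)
  moreover have "(\<Sum>w\<in>nbs v \<inter> R. y w) \<le> dR * c"
    unfolding dR_def using sum_bounded_above[of "nbs v \<inter> R" y c] c by simp
  moreover have "dL * y v \<le> real (card hubs) * y v"
    unfolding dL_def using card_nbs_hubs_le y_nonneg v by (intro mult_right_mono) auto
  moreover have "dR * y v \<le> dR * c"
    unfolding dR_def using c v by (intro mult_left_mono) auto
  moreover have "\<mu> * y v \<le> (dL + dR) * y v + ((\<Sum>w\<in>nbs v \<inter> hubs. y w) + (\<Sum>w\<in>nbs v \<inter> R. y w))"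
    using subeigen[of v] v by (simp add: deg_split sum_nbs_split[of y] dL_def dR_def)
  ultimately show ?thesis
    unfolding dL_def[symmetric] dR_def[symmetric] by (simp add: algebra_simps)
qed

lemma sum_subeigen_R:
  assumes B: "B \<subseteq> R" and c: "\<And>w. w \<in> R \<Longrightarrow> y w \<le> c"
  shows "(\<mu> - real (card hubs)) * (\<Sum>w\<in>B. y w)
    \<le> real (card hubs) * real (card B) + 2 * c * real (arcs_btw B R)"
proof -
  have "(\<mu> - real (card hubs)) * (\<Sum>w\<in>B. y w) = (\<Sum>w\<in>B. (\<mu> - real (card hubs)) * y w)"
    by (rule sum_distrib_left)
  also have "\<dots> \<le> (\<Sum>w\<in>B. real (card (nbs w \<inter> hubs)) + 2 * c * real (card (nbs w \<inter> R)))"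
    using B c by (intro sum_mono subeigen_R) auto
  also have "\<dots> = (\<Sum>w\<in>B. real (card (nbs w \<inter> hubs))) + 2 * c * real (arcs_btw B R)"
    by (simp add: sum.distrib arcs_btw_def sum_distrib_left)
  also have "(\<Sum>w\<in>B. real (card (nbs w \<inter> hubs))) \<le> real (card hubs) * real (card B)"
    using sum_bounded_above[of B "\<lambda>w. real (card (nbs w \<inter> hubs))" "real (card hubs)"] card_nbs_hubs_le
    by (simp add: mult.commute)
  finally show ?thesis by simp
qed

section \<open>Smallness off the hubs, and the number of hubs for \<open>k \<ge> 2\<close>\<close>

lemma card_V_ge: "real (card V) \<ge> 7 * real k * real k"
  using card_V by (metis (mono_tags) mult.assoc of_nat_le_iff of_nat_mult of_nat_numeral power2_eq_square)

lemma deg_R: "v \<in> R \<Longrightarrow> 2 * real (deg v) \<le> real (card V) + 2 * real k"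
  unfolding hubs_def by auto

text \<open>At a maximal non-hub \<open>v\<close> the inequality is used twice: summed over the
  non-hub neighbours \<open>B\<close>, and then at \<open>v\<close>. Erdos-Gallai keeps the sum of
  \<open>y\<close> over \<open>B\<close> linear in \<open>K\<close>, whereas \<mu> exceeds the
  degree of \<open>v\<close> by about n/2, which is quadratic in \<open>K\<close>.\<close>

lemma y_small_on_R:
  assumes k: "k \<ge> 2" and few: "card hubs < k" and v0: "v0 \<in> R"
  shows "y v0 < 2 / 7"
proof -
  have "Max (y ` R) \<in> y ` R" using v0 by (intro Max_in) auto
  then obtain v where v: "v \<in> R" and "Max (y ` R) = y v" by auto
  then have c: "\<And>w. w \<in> R \<Longrightarrow> y w \<le> y v"
    by (metis Max_ge finite_R finite_imageI imageI)
  define B where "B = nbs v \<inter> R"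
  define P where "P = \<mu> - real (card hubs)"
  define l n K where "l = real (card hubs)" and "n = real (card V)" and "K = real k"
  have K: "K \<ge> 2" using k by (simp add: K_def)
  have l: "0 \<le> l" "l \<le> K - 1" using few by (auto simp: l_def K_def)
  have n: "n \<ge> 7 * K * K" using card_V_ge by (simp add: n_def K_def)
  have n': "n \<ge> 14 * K" using n K mult_left_mono[of 2 K "7 * K"] by linarith
  have \<mu>: "\<mu> \<ge> n + 2 * K - 16 / 7" using \<mu>_ge by (simp add: n_def K_def)
  have y0: "0 \<le> y v" using v y_nonneg by auto
  have R_le: "real (card R) \<le> P"
    using card_R \<mu> K unfolding P_def n_def by linarith
  have B_le: "2 * real (card B) \<le> n + 2 * K"
    using deg_R[OF v] deg_split[of v] by (simp add: B_def n_def K_def)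
  have P_ge: "P \<ge> n + K - 9 / 7" using \<mu> l by (simp add: P_def l_def)
  have B_le_P: "7 * real (card B) \<le> 4 * P"
    using B_le P_ge n' K by linarith
  have P_pos: "P > 0" using P_ge n' K by linarith
  \<comment> \<open>Arcs between \<open>B\<close> and \<open>R - B\<close> occur in both directions
    in \<open>arcs_btw R R\<close>, which absorbs the factor 2 for them; only the arcs inside
    \<open>B\<close> have to be paid for again. The later 11/7 is 1 for \<open>R\<close> plus 4/7
    for \<open>B\<close>.\<close>
  have "2 * arcs_btw B R \<le> arcs_btw R R + arcs_btw B B"
  proof -
    have fin: "finite B" "finite (R - B)" and un: "(R - B) \<union> B = R" and disj: "(R - B) \<inter> B = {}"
      by (auto simp: B_def)
    have "arcs_btw R R = arcs_btw (R - B) R + arcs_btw B R"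
      using arcs_btw_Un_left[OF fin(2,1) disj, of R] un by simp
    moreover have "arcs_btw (R - B) R = arcs_btw (R - B) (R - B) + arcs_btw (R - B) B"
      using arcs_btw_Un_right[OF fin(2,1) disj, of "R - B"] un by simp
    moreover have "arcs_btw B R = arcs_btw B (R - B) + arcs_btw B B"
      using arcs_btw_Un_right[OF fin(2,1) disj, of B] un by simp
    ultimately show ?thesis
      using arcs_btw_commute[OF fin] by simp
  qed
  also have "\<dots> \<le> (2 * k + 1) * (card R + card B)"
    unfolding distrib_left[of _ "card R"]
    by (intro add_mono Erdos_Gallai_whole) (auto simp: B_def)
  finally have "real (2 * arcs_btw B R) \<le> real ((2 * k + 1) * (card R + card B))"
    by (rule of_nat_mono)
  then have "2 * real (arcs_btw B R) \<le> (2 * K + 1) * (real (card R) + real (card B))"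
    by (simp only: K_def of_nat_mult of_nat_add of_nat_numeral of_nat_1)
  also have "\<dots> \<le> (2 * K + 1) * (11 / 7 * P)"
    using R_le B_le_P K by (intro mult_left_mono) linarith+
  finally have arcs: "2 * real (arcs_btw B R) \<le> (2 * K + 1) * (11 / 7 * P)" .
  have "P * (\<Sum>w\<in>B. y w) \<le> l * real (card B) + 2 * y v * real (arcs_btw B R)"
    unfolding P_def l_def by (rule sum_subeigen_R) (use c in \<open>auto simp: B_def\<close>)
  also have "\<dots> \<le> l * (4 / 7 * P) + y v * ((2 * K + 1) * (11 / 7 * P))"
    using mult_left_mono[OF arcs y0] mult_left_mono[of "real (card B)" "4 / 7 * P" l] B_le_P l by simp
  also have "\<dots> = P * (4 / 7 * l + 11 / 7 * y v * (2 * K + 1))"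
    by (simp add: algebra_simps)
  finally have sum_B: "(\<Sum>w\<in>B. y w) \<le> 4 / 7 * l + 11 / 7 * y v * (2 * K + 1)"
    using P_pos by simp
  have "(\<Sum>w\<in>nbs v \<inter> hubs. y w) \<le> l"
    using sum_y_le_card[of "nbs v \<inter> hubs"] card_nbs_hubs_le[of v] hubs_subset unfolding l_def
    by fastforce
  moreover have "real (deg v) * y v \<le> (n / 2 + K) * y v"
    using deg_R[OF v] y0 by (intro mult_right_mono) (auto simp: n_def K_def)
  moreover have "\<mu> * y v \<le> real (deg v) * y v + ((\<Sum>w\<in>nbs v \<inter> hubs. y w) + (\<Sum>w\<in>B. y w))"
    using subeigen[of v] v by (simp add: sum_nbs_split[of y] B_def)
  ultimately have "\<mu> * y v \<le> (n / 2 + K) * y v + l + (4 / 7 * l + 11 / 7 * y v * (2 * K + 1))"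
    using sum_B by linarith
  moreover have "(\<mu> - n / 2 - K - 11 / 7 * (2 * K + 1)) * y v
      = \<mu> * y v - (n / 2 + K) * y v - 11 / 7 * y v * (2 * K + 1)"
    by (simp add: field_simps)
  ultimately have main: "(\<mu> - n / 2 - K - 11 / 7 * (2 * K + 1)) * y v \<le> 11 / 7 * l"
    by linarith
  have "y v < 2 / 7"
  proof (rule ccontr)
    assume "\<not> ?thesis"
    then have yv: "2 / 7 \<le> y v" by simp
    \<comment> \<open>\<open>X\<close> is the coefficient of \<open>y v\<close> in
      \<open>main\<close> after inserting the lower bounds for \<mu> and \<open>n\<close>.\<close>
    define X where "X = 7 / 2 * K * K - 15 / 7 * K - 27 / 7"
    have X: "X \<le> \<mu> - n / 2 - K - 11 / 7 * (2 * K + 1)"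
      using \<mu> n unfolding X_def by (simp add: field_simps)
    \<comment> \<open>The product is \<open>49 * K * K - 107 * K + 18\<close>, while the final
      contradiction needs \<open>49 * K * K - 107 * K + 23 > 0\<close>. This fails at
      \<open>K = 1\<close>, so that case is treated separately.\<close>
    have *: "(K - 2) * (49 * K - 9) \<ge> 0" using K by (intro mult_nonneg_nonneg) auto
    then have "X \<ge> 0" unfolding X_def using K by (simp add: algebra_simps)
    then have "2 / 7 * X \<le> y v * X" using yv by (rule mult_right_mono[rotated])
    also have "\<dots> \<le> y v * (\<mu> - n / 2 - K - 11 / 7 * (2 * K + 1))"
      using X y0 by (rule mult_left_mono)
    also have "\<dots> \<le> 11 / 7 * (K - 1)" using main l by (simp add: mult.commute)
    finally show False using * unfolding X_def by (simp add: algebra_simps)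
  qed
  then show ?thesis using c[OF v0] by linarith
qed

text \<open>Appending \<open>h\<close> and running through the other hubs gives
  \<open>2 * (k - card hubs) + 4 + 2 * card hubs - 1 = 2 * k + 3\<close> vertices. Each missing hub
  thus allows two more vertices here.\<close>

lemma no_path_in_nbs_hub:
  assumes h: "h \<in> hubs" and p: "path p" "set p \<subseteq> nbs h \<inter> R"
  shows "length p \<noteq> 2 * (k - card hubs) + 3"
proof
  assume len: "length p = 2 * (k - card hubs) + 3"
  then have ne: "p \<noteq> []" by auto
  have "path (p @ [h])"
    using p h last_in_set[OF ne] hubs_subset nbs_commute by (auto simp: path_append)
  moreover have "set (p @ [h]) \<inter> hubs = {last (p @ [h])}" using p h by auto
  moreover have "length (p @ [h]) + 2 * card hubs = 2 * k + 4"
    using len card_hubs_le by simp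
  ultimately obtain q where "path q" "length q = length (p @ [h]) + 2 * card hubs - 1"
    using hub_extend[of "p @ [h]"] by auto
  then show False
    using no_path[of q] \<open>length (p @ [h]) + 2 * card hubs = 2 * k + 4\<close> by simp
qed

text \<open>Smallness off the hubs makes the maximal vertex \<open>u\<close> a hub. The sum over its
  non-hub neighbours \<open>A\<close> is controlled by Erdos-Gallai inside \<open>A\<close>, with
  the parameter lowered by the number of hubs, and by the trivial bound between \<open>A\<close> and
  the non-neighbours \<open>W\<close>.\<close>

lemma card_hubs_ge_2:
  assumes k: "k \<ge> 2"
  shows "card hubs \<ge> k"
proof (rule ccontr)
  assume "\<not> ?thesis"
  then have few: "card hubs < k" by simp
  have small: "\<And>w. w \<in> R \<Longrightarrow> y w < 2 / 7" using y_small_on_R[OF k few] .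
  have u: "u \<in> hubs" using small[of u] u_in_V y_u by force
  define A where "A = nbs u \<inter> R"
  define W where "W = R - A"
  define P where "P = \<mu> - real (card hubs)"
  define l n K where "l = real (card hubs)" and "n = real (card V)" and "K = real k"
  define a w where "a = real (card A)" and "w = real (card W)"
  have "card hubs \<ge> 1" using u by (metis One_nat_def Suc_leI card_gt_0_iff empty_iff finite_hubs)
  then have l: "1 \<le> l" "l \<le> K - 1" using few by (auto simp: l_def K_def)
  have \<mu>: "\<mu> \<ge> n + 2 * K - 16 / 7" using \<mu>_ge by (simp add: n_def K_def)
  have fin: "finite A" "finite W" by (auto simp: A_def W_def)
  have R: "A \<union> W = R" "A \<inter> W = {}" by (auto simp: A_def W_def)
  have "card A + card W = card R" using card_Un_disjoint[OF fin R(2)] R(1) by simp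
  then have aw: "a + w = n - l" using card_R by (simp add: a_def w_def n_def l_def)
  have aw0: "a \<ge> 0" "w \<ge> 0" by (auto simp: a_def w_def)
  have a_less: "a < P" using aw aw0 \<mu> l unfolding P_def l_def by linarith
  have "arcs_btw A A \<le> (2 * (k - card hubs) + 1) * card A"
    using Erdos_Gallai[of A "k - card hubs"] no_path_in_nbs_hub[OF u] fin by (auto simp: A_def)
  then have "real (arcs_btw A A) \<le> real ((2 * (k - card hubs) + 1) * card A)"
    by (rule of_nat_mono)
  also have "\<dots> = (2 * (K - l) + 1) * a"
  proof -
    have "real (k - card hubs) = K - l" using few by (simp add: K_def l_def of_nat_diff)
    then show ?thesis
      by (simp only: a_def of_nat_mult of_nat_add of_nat_numeral of_nat_1)
  qed
  finally have AA: "real (arcs_btw A A) \<le> (2 * (K - l) + 1) * a" .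
  have "real (arcs_btw A W) \<le> real (card A * card W)"
    using arcs_btw_le_mult[OF fin] by (rule of_nat_mono)
  then have AW: "real (arcs_btw A W) \<le> a * w" by (simp add: a_def w_def)
  have "arcs_btw A R = arcs_btw A A + arcs_btw A W"
    using arcs_btw_Un_right[OF fin R(2)] R(1) by simp
  then have AR: "real (arcs_btw A R) \<le> a * (2 * (K - l) + 1 + w)"
    using AA AW by (simp add: algebra_simps)
  define Y where "Y = l + 4 / 7 * (2 * (K - l) + 1 + w)"
  have Y: "Y > 0" unfolding Y_def using l aw0 by (intro add_pos_nonneg) auto
  have "P * (\<Sum>w\<in>A. y w) \<le> l * a + 2 * (2 / 7) * real (arcs_btw A R)"
    unfolding P_def l_def a_def using small
    by (intro sum_subeigen_R) (auto simp: A_def less_imp_le)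
  also have "\<dots> \<le> a * Y"
    using AR unfolding Y_def by (simp add: algebra_simps)
  also have "\<dots> < P * Y" using a_less Y by simp
  finally have A_sum: "(\<Sum>w\<in>A. y w) < Y" using a_less aw0 by simp
  have "nbs u \<inter> hubs \<subseteq> hubs - {u}" by auto
  then have "card (nbs u \<inter> hubs) \<le> card (hubs - {u})" by (intro card_mono) auto
  then have dL: "real (card (nbs u \<inter> hubs)) \<le> l - 1"
    using u \<open>card hubs \<ge> 1\<close> by (simp add: l_def)
  moreover have "(\<Sum>w\<in>nbs u \<inter> hubs. y w) \<le> real (card (nbs u \<inter> hubs))"
    by (rule sum_y_le_card) (use hubs_subset in auto)
  moreover have "\<mu> \<le> real (card (nbs u \<inter> hubs)) + a + ((\<Sum>w\<in>nbs u \<inter> hubs. y w) + (\<Sum>w\<in>A. y w))"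
    using subeigen[OF u_in_V] y_u by (simp add: sum_nbs_split[of y] deg_split A_def a_def)
  ultimately have "\<mu> < 2 * (l - 1) + a + Y" using A_sum by simp
  \<comment> \<open>Since \<open>a = n - l - w\<close>, the right side equals
    \<open>n + 6/7 * l + 8/7 * K - 10/7 - 3/7 * w\<close>. For \<open>l = K - 1\<close> and
    \<open>w = 0\<close> this is exactly \<open>n + 2 * K - 16/7\<close>, so the strict inequality
    is essential.\<close>
  then show False
    using \<mu> aw aw0 l unfolding Y_def by (simp add: field_simps)
qed

text \<open>Let \<open>x\<close> be a non-leaf neighbour of \<open>v\<close> and \<open>a\<close> a
  further neighbour of \<open>x\<close>. A third non-leaf neighbour \<open>w\<close> of
  \<open>v\<close> would complete a path on five vertices, whether its second neighbour is new,
  equal to \<open>a\<close>, or equal to \<open>x\<close>.\<close>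

lemma card_nonleaf_nbs:
  assumes "k = 1" "deg v \<ge> 4"
  shows "card {w \<in> nbs v. deg w \<ge> 2} \<le> 2"
proof -
  have other: "\<exists>b\<in>nbs w. b \<noteq> x" if "deg w \<ge> 2" for w x
  proof (rule ccontr)
    assume "\<not> ?thesis"
    then have "nbs w \<subseteq> {x}" by auto
    then have "deg w \<le> 1" unfolding deg_def using card_mono[of "{x}" "nbs w"] by simp
    then show False using that by simp
  qed
  have no5: "\<not> path [p, q, r, s, t]" for p q r s t
    using no_path[of "[p, q, r, s, t]"] assms(1) by auto
  show ?thesis
  proof (cases "{w \<in> nbs v. deg w \<ge> 2} = {}")
    case True
    then show ?thesis by (simp only: card.empty)
  next
    case False
    then obtain x where x: "x \<in> nbs v" "deg x \<ge> 2" by auto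
    obtain a where a: "a \<in> nbs x" "a \<noteq> v" using other[OF x(2)] by blast
    have "{w \<in> nbs v. deg w \<ge> 2} \<subseteq> {x, a}"
    proof (rule ccontr)
      assume "\<not> ?thesis"
      then obtain w where w: "w \<in> nbs v" "deg w \<ge> 2" "w \<noteq> x" "w \<noteq> a" by auto
      obtain b where b: "b \<in> nbs w" "b \<noteq> v" using other[OF w(2)] by blast
      \<comment> \<open>Degree at least 4 supplies a spare neighbour \<open>z\<close> of
        \<open>v\<close>, the end of the path in the last two cases.\<close>
      have "card {x, a, w} < deg v" using assms(2) card_insert_le_m1[of 3 "{a, w}" x]
        by (auto simp: card_insert_if)
      then have "\<not> nbs v \<subseteq> {x, a, w}"
        unfolding deg_def by (meson card_mono finite.emptyI finite.insertI not_le)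
      then obtain z where z: "z \<in> nbs v" "z \<noteq> x" "z \<noteq> a" "z \<noteq> w" by auto
      have inV: "x \<in> V" "a \<in> V" "w \<in> V" "b \<in> V" "z \<in> V" "v \<in> V"
        using x a w b z nbs_in_V by blast+
      have neq: "x \<noteq> v" "a \<noteq> x" "w \<noteq> v" "b \<noteq> w" "z \<noteq> v"
        using x a w b z not_in_nbs by metis+
      consider "b \<noteq> x \<and> b \<noteq> a" | "b = a" | "b = x" by blast
      then show False
      proof cases
        case 1
        have "path [a, x, v, w, b]"
          using 1 x a w b z inV neq nbs_commute by (auto simp: path_Cons)
        then show False using no5 by blast
      next
        case 2
        have "path [w, a, x, v, z]"
          using 2 x a w b z inV neq nbs_commute by (auto simp: path_Cons)
        then show False using no5 by blast
      next
        case 3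
        have "path [a, x, w, v, z]"
          using 3 x a w b z inV neq nbs_commute by (auto simp: path_Cons)
        then show False using no5 by blast
      qed
    qed
    then have "card {w \<in> nbs v. deg w \<ge> 2} \<le> card {x, a}" by (intro card_mono) auto
    also have "\<dots> \<le> 2" by (simp add: card_insert_if)
    finally show ?thesis .
  qed
qed

text \<open>Leaves at the maximal vertex have value at most 1/(\<mu> - 1), so altogether they add
  little more than at most two non-leaf neighbours do. The neighbour sum stays below 3, which forces
  the degree of \<open>u\<close> close to \<mu>.\<close>

lemma card_hubs_ge_1:
  assumes k: "k = 1"
  shows "card hubs \<ge> k"
proof -
  define N where "N = {w \<in> nbs u. deg w \<ge> 2}"
  define d m where "d = real (deg u)" and "m = real (card N)"
  have n7: "card V \<ge> 7" using card_V k by simp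
  have \<mu>: "\<mu> \<ge> real (card V)" using \<mu>_ge_1[OF k] .
  have d4: "deg u \<ge> 4" using two_deg_u \<mu> n7 by simp
  have m: "0 \<le> m" "m \<le> 2" using card_nonleaf_nbs[OF k d4] by (auto simp: m_def N_def)
  have N: "N \<subseteq> nbs u" by (auto simp: N_def)
  have leaf: "(\<mu> - 1) * y w \<le> 1" if "w \<in> nbs u - N" for w
  proof -
    have "deg w \<le> 1" "u \<in> nbs w" using that nbs_commute by (auto simp: N_def)
    then have "nbs w = {u}"
      using card_le_Suc0_iff_eq[of "nbs w"] by (auto simp: deg_def)
    moreover from this have "deg w = 1" by (simp add: deg_def)
    ultimately show ?thesis
      using subeigen[of w] nbs_in_V(2)[of w u] that y_u by (simp add: algebra_simps)
  qed
  have "(\<mu> - 1) * (\<Sum>w\<in>nbs u - N. y w) \<le> (\<Sum>w\<in>nbs u - N. 1)"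
    unfolding sum_distrib_left by (rule sum_mono) (rule leaf)
  also have "\<dots> = d - m"
    using N by (simp add: d_def m_def deg_def card_Diff_subset finite_subset of_nat_diff card_mono)
  finally have 1: "(\<mu> - 1) * (\<Sum>w\<in>nbs u - N. y w) \<le> d - m" .
  have "(\<Sum>w\<in>N. y w) \<le> m"
    unfolding m_def by (rule sum_y_le_card) (use N nbs_subset in blast)
  then have 2: "(\<mu> - 1) * (\<Sum>w\<in>N. y w) \<le> (\<mu> - 1) * m"
    using \<mu> n7 by (intro mult_left_mono) auto
  have "(\<Sum>w\<in>nbs u. y w) = (\<Sum>w\<in>nbs u - N. y w) + (\<Sum>w\<in>N. y w)"
    using sum.subset_diff[OF N finite_nbs] .
  then have "(\<mu> - 1) * (\<Sum>w\<in>nbs u. y w) \<le> d - m + (\<mu> - 1) * m"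
    using 1 2 by (simp add: distrib_left)
  also have "\<dots> = d + (\<mu> - 2) * m" by (simp add: algebra_simps)
  also have "\<dots> \<le> d + (\<mu> - 2) * 2"
    using m \<mu> n7 by (intro add_left_mono mult_left_mono) auto
  also have "\<dots> < (\<mu> - 1) * 3"
    using deg_less[OF u_in_V] \<mu> by (simp add: d_def)
  finally have "(\<Sum>w\<in>nbs u. y w) < 3"
    by (rule mult_left_less_imp_less) (use \<mu> n7 in simp)
  then have "\<mu> < real (deg u) + 3"
    using subeigen[OF u_in_V] y_u by simp
  \<comment> \<open>Hence \<open>deg u \<ge> card V - 2\<close>, which makes \<open>u\<close> a hub
    as soon as \<open>card V \<ge> 7\<close>. The general bound on \<mu> would only give
    \<open>card V - 3\<close>, too little for 7 or 8 vertices.\<close>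
  then have "real (card V) < real (deg u + 3)" using \<mu> by simp
  then have "card V < deg u + 3" by (simp only: of_nat_less_iff)
  then have "card V + 2 * k + 1 \<le> 2 * deg u" using n7 k by linarith
  then have "u \<in> hubs" using u_in_V by (simp add: hubs_def)
  then show ?thesis
    using k by (metis One_nat_def Suc_leI card_gt_0_iff empty_iff finite_hubs)
qed

lemma card_hubs: "card hubs = k"
  using card_hubs_le card_hubs_ge_1 card_hubs_ge_2 k_pos by (cases "k = 1") (auto intro: antisym)

end

section \<open>The graph outside the hubs\<close>

context simple_graph
begin

definition Q :: "('a \<Rightarrow> real) \<Rightarrow> 'a \<Rightarrow> real" where
  "Q f v = real (deg v) * f v + (\<Sum>w\<in>nbs v. f w)"

lemma Q_symmetric: "(\<Sum>v\<in>V. f v * Q g v) = (\<Sum>v\<in>V. g v * Q f v)"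
proof -
  have nb: "(\<Sum>w\<in>nbs v. f w) = (\<Sum>w\<in>V. if w \<in> nbs v then f w else 0)" for f :: "'a \<Rightarrow> real" and v
    using nbs_subset finite_V by (simp add: sum.inter_restrict[symmetric] Int_absorb1)
  have "(\<Sum>v\<in>V. f v * (\<Sum>w\<in>nbs v. g w)) = (\<Sum>v\<in>V. \<Sum>w\<in>V. if w \<in> nbs v then f v * g w else 0)"
    by (simp add: nb sum_distrib_left if_distrib cong: if_cong)
  also have "\<dots> = (\<Sum>w\<in>V. \<Sum>v\<in>V. if w \<in> nbs v then f v * g w else 0)"
    by (rule sum.swap)
  also have "\<dots> = (\<Sum>w\<in>V. \<Sum>v\<in>V. if v \<in> nbs w then g w * f v else 0)"
    by (intro sum.cong refl) (simp add: nbs_commute mult.commute)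
  also have "\<dots> = (\<Sum>v\<in>V. g v * (\<Sum>w\<in>nbs v. f w))"
    by (simp add: nb sum_distrib_left if_distrib cong: if_cong)
  finally show ?thesis
    by (simp add: Q_def distrib_left sum.distrib mult_ac)
qed

text \<open>By symmetry the sum of \<open>w v * Q y v\<close> lies between \<mu> and \<theta> times
  the positive sum of \<open>w v * y v\<close>. Equality then holds term by term; as
  \<open>w\<close> is positive, \<open>y\<close> becomes an eigenfunction everywhere, but
  \<open>w\<close> satisfies equality only where \<open>y\<close> is nonzero.\<close>

lemma comparison:
  assumes y_all: "\<forall>v\<in>V. 0 \<le> y v" "\<forall>v\<in>V. \<mu> * y v \<le> Q y v"
    and w_all: "\<forall>v\<in>V. 0 < w v" "\<forall>v\<in>V. Q w v \<le> \<theta> * w v"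
    and u: "u \<in> V" "0 < y u" and le: "\<theta> \<le> \<mu>"
  shows "\<mu> = \<theta>"
    and "\<And>v. v \<in> V \<Longrightarrow> Q y v = \<theta> * y v"
    and "\<And>v. v \<in> V \<Longrightarrow> y v \<noteq> 0 \<Longrightarrow> Q w v = \<theta> * w v"
proof -
  note y = y_all[rule_format] and w = w_all[rule_format]
  define W where "W = (\<Sum>v\<in>V. w v * y v)"
  have "0 < w u * y u" using u w by simp
  also have "\<dots> \<le> W"
    unfolding W_def using u finite_V w(1) y(1) by (intro member_le_sum) (auto simp: less_imp_le)
  finally have W: "W > 0" .
  have 1: "\<mu> * W \<le> (\<Sum>v\<in>V. w v * Q y v)"
    unfolding W_def sum_distrib_left
  proof (rule sum_mono)
    fix v assume v: "v \<in> V"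
    have "w v * (\<mu> * y v) \<le> w v * Q y v"
      using w(1)[OF v] y(2)[OF v] by (intro mult_left_mono) auto
    then show "\<mu> * (w v * y v) \<le> w v * Q y v" by (simp add: mult.left_commute)
  qed
  have 2: "(\<Sum>v\<in>V. y v * Q w v) \<le> \<theta> * W"
    unfolding W_def sum_distrib_left
  proof (rule sum_mono)
    fix v assume v: "v \<in> V"
    have "y v * Q w v \<le> y v * (\<theta> * w v)"
      using y(1)[OF v] w(2)[OF v] by (intro mult_left_mono) auto
    then show "y v * Q w v \<le> \<theta> * (w v * y v)" by (simp add: mult_ac)
  qed
  have "\<mu> * W \<le> \<theta> * W" using 1 2 Q_symmetric[of w y] by linarith
  then have "\<mu> \<le> \<theta>" using W by simp
  then show eq: "\<mu> = \<theta>" using le by simp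
  have sum1: "(\<Sum>v\<in>V. w v * (Q y v - \<theta> * y v)) = (\<Sum>v\<in>V. w v * Q y v) - \<theta> * W"
    by (simp add: W_def sum_distrib_left right_diff_distrib sum_subtractf mult.left_commute)
  have sum2: "(\<Sum>v\<in>V. y v * (\<theta> * w v - Q w v)) = \<theta> * W - (\<Sum>v\<in>V. y v * Q w v)"
    by (simp add: W_def sum_distrib_left right_diff_distrib sum_subtractf mult_ac)
  have "(\<Sum>v\<in>V. w v * (Q y v - \<theta> * y v)) = 0"
    using sum1 1 2 Q_symmetric[of w y] eq by simp
  then have "\<forall>v\<in>V. w v * (Q y v - \<theta> * y v) = 0"
    using y(2) w(1) eq by (subst (asm) sum_nonneg_eq_0_iff[OF finite_V]) (auto simp: less_imp_le)
  then show "Q y v = \<theta> * y v" if "v \<in> V" for v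
    using w(1)[OF that] that by force
  have "(\<Sum>v\<in>V. y v * (\<theta> * w v - Q w v)) = 0"
    using sum2 1 2 Q_symmetric[of w y] eq by simp
  then show "Q w v = \<theta> * w v" if "v \<in> V" "y v \<noteq> 0" for v
    using that y(1) w(2)
    by (subst (asm) sum_nonneg_eq_0_iff[OF finite_V]) auto
qed

end

context subeigenvector
begin

text \<open>The graph induced by \<open>R\<close>, as far as it is seen by the hubs, consists of isolated vertices,
  stars whose centre alone is adjacent to hubs, and single edges with both ends adjacent to hubs.\<close>

definition T :: "'a set" where "T = {v \<in> R. nbs v \<inter> hubs \<noteq> {}}"

definition centres :: "'a set" where "centres = {v \<in> T. nbs v \<inter> R \<noteq> {} \<and> nbs v \<inter> T = {}}"

definition leaves :: "'a set" where "leaves = {v \<in> R - T. nbs v \<inter> T \<noteq> {}}"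

definition paired :: "'a set" where "paired = {v \<in> T. nbs v \<inter> T \<noteq> {}}"

lemma finite_T: "finite T"
  using finite_subset[of T R] by (auto simp: T_def)

text \<open>A second non-hub neighbour \<open>a\<close> of \<open>b\<close> would give a path
  \<open>a\<close>, \<open>b\<close>, \<open>v\<close> ending in a hub, which extends through all
  hubs to \<open>2 * k + 3\<close> vertices.\<close>

lemma second_nbs:
  assumes "v \<in> T" "b \<in> nbs v \<inter> R"
  shows "nbs b \<inter> R = {v}"
proof (rule ccontr)
  assume ne: "\<not> ?thesis"
  have "v \<in> nbs b \<inter> R" using assms nbs_commute by (auto simp: T_def)
  then obtain a where a: "a \<in> nbs b" "a \<in> R" "a \<noteq> v" using ne by blast
  obtain h where h: "h \<in> nbs v" "h \<in> hubs" using assms(1) by (auto simp: T_def)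
  have "a \<noteq> b" using a(1) by auto
  moreover have "b \<noteq> v" using assms(2) by auto
  moreover have "v \<in> R" using assms(1) by (simp add: T_def)
  ultimately have "path [a, b, v, h]"
    using a assms(2) h hubs_subset nbs_commute by (auto simp: path_Cons)
  moreover have "set [a, b, v, h] \<inter> hubs = {last [a, b, v, h]}"
    using a assms h \<open>v \<in> R\<close> by auto
  moreover have "length [a, b, v, h] + 2 * card hubs \<le> 2 * k + 4"
    using card_hubs by simp
  ultimately obtain q where "path q" "length q = length [a, b, v, h] + 2 * card hubs - 1"
    using hub_extend[of "[a, b, v, h]"] by blast
  then show False using no_path[of q] card_hubs by simp
qed

text \<open>Two disjoint edges can be the two ends of a path \<open>b\<close>, \<open>a\<close>,
  \<open>h\<close>, ..., \<open>h'\<close>, \<open>c\<close>, \<open>d\<close> through all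
  \<open>k\<close> hubs, with \<open>2 + (2 * k - 1) + 2\<close> vertices. Such a chain from
  \<open>h\<close> to \<open>h'\<close> exists if they differ, or if they are the only hub.\<close>

lemma hub_unique:
  assumes ab: "a \<in> R" "b \<in> R" "b \<in> nbs a" and cd: "c \<in> R" "d \<in> R" "d \<in> nbs c"
    and disj: "{a, b} \<inter> {c, d} = {}"
    and h: "h \<in> nbs a \<inter> hubs" "h' \<in> nbs c \<inter> hubs"
  shows "k \<noteq> 1" and "h = h'"
proof -
  have False if *: "k = 1 \<or> h \<noteq> h'"
  proof -
    have "\<exists>hs. distinct hs \<and> set hs = hubs - {h} \<and> last (h # hs) = h'"
    proof (cases "h = h'")
      case True
      then have "card hubs = 1" using * card_hubs by simp
      then obtain x where "hubs = {x}" by (rule card_1_singletonE)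
      then have "hubs = {h}" using h by auto
      then show ?thesis using True by (intro exI[of _ "[]"]) auto
    next
      case False
      obtain hs where "set hs = hubs - {h, h'}" "distinct hs"
        using finite_distinct_list[of "hubs - {h, h'}"] by auto
      then show ?thesis using False h by (intro exI[of _ "hs @ [h']"]) auto
    qed
    then obtain hs where hs: "distinct hs" "set hs = hubs - {h}" "last (h # hs) = h'" by blast
    have len: "length hs = k - 1"
      using hs(1,2) h(1) card_hubs by (metis IntD2 card_Diff_singleton distinct_card)
    have inV: "a \<in> V" "b \<in> V" "c \<in> V" "d \<in> V" "h \<in> V" using ab cd h hubs_subset by auto
    have "a \<noteq> b" "c \<noteq> d" using ab cd by auto
    have p: "path [b, a, h]"
      using ab h inV \<open>a \<noteq> b\<close> nbs_commute by (auto simp: path_Cons)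
    have dist: "set hs \<inter> set [b, a, h] = {}" "{c, d} \<inter> (set [b, a, h] \<union> set hs) = {}"
      using ab cd h hs(2) disj by auto
    have "length [b, a, h] + 2 * length hs + card {c, d} \<le> 2 * k + 3"
      using len k_pos \<open>c \<noteq> d\<close> by simp
    moreover have "last [b, a, h] \<in> hubs" "set hs \<subseteq> hubs" "finite {c, d}" "[b, a, h] \<noteq> []"
      using h hs by auto
    ultimately obtain q where q: "path ([b, a, h] @ q)" "length q = 2 * length hs"
        "set q \<inter> {c, d} = {}" "last ([b, a, h] @ q) = last (last [b, a, h] # hs)"
      using hub_chain[OF p, of hs "{c, d}"] hs(1) dist by blast
    have "last (last [b, a, h] # hs) = h'" using hs(3) by simp
    then have "last ([b, a, h] @ q) = h'" using q(4) by metis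
    moreover have "path [c, d]" using cd inV \<open>c \<noteq> d\<close> by (auto simp: path_Cons)
    moreover have "set ([b, a, h] @ q) \<inter> set [c, d] = {}" using dist(2) q(3) by auto
    ultimately have "path (([b, a, h] @ q) @ [c, d])"
      using q(1) h(2) nbs_commute by (subst path_append) auto
    moreover have "length (([b, a, h] @ q) @ [c, d]) = 2 * k + 3"
      using q(2) len k_pos by simp
    ultimately show False using no_path by blast
  qed
  then show "k \<noteq> 1" "h = h'" by blast+
qed

lemma obtain_hub: obtains h where "h \<in> hubs"
  using card_hubs k_pos by (metis card.empty ex_in_conv not_one_le_zero)

text \<open>A vertex outside \<open>T\<close> and the hubs is a non-neighbour of every hub, and a
  single hub already has few non-neighbours.\<close>

lemma untouched_few:
  assumes "X \<subseteq> R - T"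
  shows "2 * real (card X) \<le> real (card V) - 2 * real k - 1"
proof -
  obtain h where h: "h \<in> hubs" by (rule obtain_hub)
  have "X \<subseteq> V - nbs h" using assms h nbs_commute unfolding T_def by blast
  then have "card X \<le> card (V - nbs h)" using finite_V by (intro card_mono) auto
  also have "\<dots> = card V - deg h"
    using nbs_subset by (simp add: deg_def card_Diff_subset)
  finally have "2 * card X + 2 * k + 1 \<le> card V"
    using hub_deg[OF h] deg_less[of h] h hubs_subset by fastforce
  then show ?thesis by linarith
qed

lemma leaf_nbs:
  assumes "v \<in> leaves"
  obtains z where "z \<in> centres" "nbs v = {z}"
proof -
  obtain z where z: "z \<in> nbs v" "z \<in> T" and v: "v \<in> R" "v \<notin> T"
    using assms by (auto simp: leaves_def)
  have vz: "v \<in> nbs z \<inter> R" using z v nbs_commute by auto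
  have "nbs v \<inter> hubs = {}" using v by (auto simp: T_def)
  then have "nbs v = {z}" using second_nbs[OF z(2) vz] nbs_split[of v] by auto
  moreover have "nbs z \<inter> T = {}"
  proof (rule ccontr)
    assume "\<not> ?thesis"
    then obtain b where b: "b \<in> nbs z" "b \<in> T" by auto
    then have "z \<in> nbs b \<inter> R" using z(2) by (auto simp: T_def nbs_commute)
    then have "nbs z \<inter> R = {b}" using second_nbs[OF b(2)] by blast
    then show False using vz b v by auto
  qed
  then have "z \<in> centres" using z vz by (auto simp: centres_def)
  ultimately show ?thesis using that by blast
qed

lemma centre_nbs: "v \<in> centres \<Longrightarrow> nbs v \<inter> R \<subseteq> leaves"
  by (auto simp: centres_def leaves_def nbs_commute)

lemma paired_nbs:
  assumes "v \<in> paired"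
  obtains b where "b \<in> paired" "nbs v \<inter> R = {b}" "nbs b \<inter> R = {v}"
proof -
  obtain b where b: "b \<in> nbs v" "b \<in> T" and v: "v \<in> T" using assms by (auto simp: paired_def)
  have bR: "b \<in> nbs v \<inter> R" and vR: "v \<in> nbs b \<inter> R" using b v nbs_commute by (auto simp: T_def)
  have "b \<in> paired" using b v vR by (auto simp: paired_def)
  then show ?thesis using that second_nbs[OF v bR] second_nbs[OF b(2) vR] by blast
qed

lemma isolated_nbs: "v \<in> T - centres - paired \<Longrightarrow> nbs v \<inter> R = {}"
  by (auto simp: centres_def paired_def)

lemma far_nbs:
  assumes "v \<in> R - T - leaves"
  shows "nbs v \<subseteq> R - T - leaves"
proof
  fix x assume x: "x \<in> nbs v"
  have "nbs v \<inter> hubs = {}" "nbs v \<inter> T = {}" using assms by (auto simp: T_def leaves_def)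
  then have "x \<in> R - T" using x nbs_subset by blast
  moreover have "x \<notin> leaves"
  proof
    assume "x \<in> leaves"
    then obtain z where "z \<in> centres" "nbs x = {z}" by (rule leaf_nbs)
    then have "v = z" "z \<in> T" using x nbs_commute by (auto simp: centres_def)
    then show False using assms by blast
  qed
  ultimately show "x \<in> R - T - leaves" by blast
qed

text \<open>Each centre owns a leaf. In the balance at a hub, the leaves invisible to it must pay
  for centres having weight 1 instead of the smaller \<gamma>.\<close>

lemma card_centres_le: "card centres \<le> card leaves"
proof -
  have "centres \<subseteq> (\<lambda>v. the_elem (nbs v)) ` leaves"
  proof
    fix z assume z: "z \<in> centres"
    then obtain v where v: "v \<in> nbs z" "v \<in> leaves"
      using centre_nbs[OF z] by (auto simp: centres_def)
    then obtain z' where "nbs v = {z'}" using leaf_nbs by blast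
    moreover have "z \<in> nbs v" using v(1) nbs_commute by blast
    ultimately have "nbs v = {z}" by auto
    then show "z \<in> (\<lambda>v. the_elem (nbs v)) ` leaves"
      using v(2) by (intro image_eqI[of _ _ v]) simp_all
  qed
  moreover have "finite leaves" by (rule finite_subset[of _ R]) (auto simp: leaves_def)
  ultimately show ?thesis by (rule surj_card_le[rotated])
qed

lemma card_nbs_hub_le:
  assumes "h \<in> hubs"
  shows "card (nbs h \<inter> hubs) \<le> k - 1"
proof -
  have "nbs h \<inter> hubs \<subseteq> hubs - {h}" by auto
  then have "card (nbs h \<inter> hubs) \<le> card (hubs - {h})" by (intro card_mono) auto
  then show ?thesis using assms card_hubs by simp
qed

end

section \<open>Comparison with the extremal graphs\<close>

context subeigenvector
begin

text \<open>The values solve local eigenvalue equations: \<gamma> will satisfy \<theta>\<gamma> =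
  k\<gamma> + k, for a vertex joined to exactly the \<open>k\<close> hubs, and x = 1/(\<theta> - 1)
  satisfies \<theta>x = x + 1, for a leaf at a vertex of weight 1. The value \<beta> on single edges
  stays a parameter because it is chosen differently according to their number.\<close>

definition weight :: "real \<Rightarrow> real \<Rightarrow> real \<Rightarrow> 'a \<Rightarrow> real" where
  "weight \<theta> \<gamma> \<beta> v =
     (if v \<in> hubs \<union> centres then 1 else if v \<in> leaves then 1 / (\<theta> - 1)
      else if v \<in> paired then \<beta> else \<gamma>)"

lemma classes:
  "centres \<subseteq> T" "paired \<subseteq> T" "centres \<inter> paired = {}" "leaves \<subseteq> R - T" "T \<subseteq> R"
  by (auto simp: centres_def paired_def leaves_def T_def)

lemma finite_classes [simp]: "finite centres" "finite paired" "finite leaves"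
  using classes finite_T by (auto intro: finite_subset[of _ T] finite_subset[of _ R])

text \<open>\<open>\<theta>_eq\<close> is the eigenvalue equation at a hub of weight 1 adjacent to
  everything: n - 1 from its degree, k - 1 from the other hubs, \<gamma> from each remaining vertex.
  The allowance \<tau> is what single edges may add; it is 0 for \<open>S_graph\<close> and
  2(\<beta> - \<gamma>) for \<open>S_plus_graph\<close>.\<close>

context
  fixes \<theta> \<gamma> \<beta> \<tau> :: real
  assumes \<theta>_le: "\<theta> \<le> \<mu>"
    and \<theta>_ge: "\<theta> \<ge> real (card V) + 2 * real k - 16 / 7"
    and \<theta>_eq: "\<theta> = 2 * (real k - 1) + (real (card V) - real k) * (1 + \<gamma>) + \<tau>"
    and \<gamma>: "\<gamma> = real k / (\<theta> - real k)"
    and \<beta>_pos: "\<beta> > 0"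
    and paired_ok: "\<forall>v\<in>paired.
      real (card (nbs v \<inter> hubs)) + (real (card (nbs v \<inter> hubs)) + 2) * \<beta> \<le> \<theta> * \<beta>"
    and \<tau>: "real (card paired) * (\<beta> - \<gamma>) \<le> \<tau>"
begin

private abbreviation (input) "w \<equiv> weight \<theta> \<gamma> \<beta>"

lemma card_V_7: "real (card V) \<ge> 7" "real (card V) \<ge> 7 * real k"
proof -
  have "1 \<le> real k * real k" "real k \<le> real k * real k"
    using k_pos by (simp_all add: mult_ge1_I)
  then show "real (card V) \<ge> 7" "real (card V) \<ge> 7 * real k" using card_V_ge by linarith+
qed

lemma \<theta>_bounds: "\<theta> > 4" "\<theta> > real k"
  using \<theta>_ge card_V_7 k_pos by linarith+

lemma \<gamma>_pos: "\<gamma> > 0" and \<gamma>_mult: "(\<theta> - real k) * \<gamma> = real k"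
  using \<gamma> \<theta>_bounds k_pos by simp_all

lemma w_pos: "w v > 0"
  using \<gamma>_pos \<beta>_pos \<theta>_bounds by (simp add: weight_def)

lemma w_values:
  "v \<in> hubs \<Longrightarrow> w v = 1" "v \<in> centres \<Longrightarrow> w v = 1" "v \<in> leaves \<Longrightarrow> w v = 1 / (\<theta> - 1)"
  "v \<in> paired \<Longrightarrow> w v = \<beta>" "v \<in> R - centres - leaves - paired \<Longrightarrow> w v = \<gamma>"
  using classes by (auto simp: weight_def)

lemma sum_w_hubs: "(\<Sum>x\<in>nbs v \<inter> hubs. w x) = real (card (nbs v \<inter> hubs))"
  by (simp add: w_values(1))

lemma Q_w: "Q w v = (real (card (nbs v \<inter> hubs)) + real (card (nbs v \<inter> R))) * w v
    + real (card (nbs v \<inter> hubs)) + (\<Sum>x\<in>nbs v \<inter> R. w x)"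
  by (simp add: Q_def deg_split sum_nbs_split[of w] sum_w_hubs)

lemma card_nbs_hubs_k: "real (card (nbs v \<inter> hubs)) \<le> real k"
  using card_nbs_hubs_le card_hubs by simp

lemma deg_far:
  assumes "v \<in> R - T"
  shows "2 * real (deg v) < \<theta>"
proof (cases "v \<in> leaves")
  case True
  then obtain z where "nbs v = {z}" by (rule leaf_nbs)
  then show ?thesis using \<theta>_bounds by (simp add: deg_def)
next
  case False
  then have "nbs v \<subseteq> R - T" using far_nbs[of v] assms by blast
  then show ?thesis using untouched_few[of "nbs v"] \<theta>_ge k_pos by (simp add: deg_def)
qed

lemma Q_w_R:
  assumes v: "v \<in> R"
  shows "Q w v \<le> \<theta> * w v"
proof -
  define t where "t = real (card (nbs v \<inter> hubs))"
  have t: "0 \<le> t" "t \<le> real k" using card_nbs_hubs_k by (auto simp: t_def)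
  consider "v \<in> centres" | "v \<in> leaves" | "v \<in> paired" | "v \<in> T - centres - paired"
    | "v \<in> R - T - leaves"
    using v by blast
  then show ?thesis
  proof cases
    case 1
    define s where "s = real (card (nbs v \<inter> R))"
    have sub: "nbs v \<inter> R \<subseteq> R - T" using centre_nbs[OF 1] classes by blast
    have s: "2 * s \<le> real (card V) - 2 * real k - 1" "0 \<le> s"
      using untouched_few[OF sub] by (auto simp: s_def)
    have "(\<Sum>x\<in>nbs v \<inter> R. w x) = s * (1 / (\<theta> - 1))"
      using centre_nbs[OF 1] w_values(3) by (simp add: s_def subset_iff)
    \<comment> \<open>The leaves of a centre are missed by every hub, so there are fewer than n/2 of
      them, and their weights total at most 1.\<close>
    also have "\<dots> \<le> (\<theta> - 1) * (1 / (\<theta> - 1))"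
      using s \<theta>_ge \<theta>_bounds k_pos by (intro mult_right_mono) auto
    also have "\<dots> = 1" using \<theta>_bounds by simp
    finally have "(\<Sum>x\<in>nbs v \<inter> R. w x) \<le> 1" .
    then have "Q w v \<le> t + s + t + 1"
      using w_values(2)[OF 1] by (simp add: Q_w t_def s_def)
    also have "\<dots> \<le> \<theta>" using s t \<theta>_ge card_V_7 k_pos by linarith
    finally show ?thesis using w_values(2)[OF 1] by simp
  next
    case 2
    then obtain z where z: "z \<in> centres" "nbs v = {z}" by (rule leaf_nbs)
    then have "Q w v = 1 / (\<theta> - 1) + 1"
      using w_values(3)[OF 2] w_values(2)[OF z(1)] by (simp add: Q_def deg_def)
    also have "\<dots> = \<theta> * (1 / (\<theta> - 1))" using \<theta>_bounds by (simp add: field_simps)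
    finally show ?thesis using w_values(3)[OF 2] by simp
  next
    case 3
    then obtain b where b: "b \<in> paired" "nbs v \<inter> R = {b}" by (rule paired_nbs)
    have "Q w v = (t + 1) * \<beta> + t + \<beta>"
      unfolding Q_w b(2) w_values(4)[OF 3] using w_values(4)[OF b(1)] by (simp add: t_def)
    also have "\<dots> = t + (t + 2) * \<beta>" by (simp add: algebra_simps)
    also have "\<dots> \<le> \<theta> * \<beta>" using bspec[OF paired_ok 3] by (simp add: t_def)
    finally show ?thesis using w_values(4)[OF 3] by simp
  next
    case 4
    then have w: "w v = \<gamma>" using w_values(5)[of v] classes by blast
    have "Q w v = t * \<gamma> + t"
      unfolding Q_w isolated_nbs[OF 4] w by (simp add: t_def)
    also have "\<dots> \<le> real k * \<gamma> + real k"
      using t \<gamma>_pos by (intro add_mono mult_right_mono) auto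
    also have "\<dots> = \<theta> * \<gamma>" using \<gamma>_mult by (simp add: algebra_simps)
    finally show ?thesis using w by simp
  next
    case 5
    then have far: "w x = \<gamma>" if "x \<in> R - T - leaves" for x
      using w_values(5)[of x] classes that by blast
    have "(\<Sum>x\<in>nbs v. w x) = (\<Sum>x\<in>nbs v. \<gamma>)"
      using far far_nbs[OF 5] by (intro sum.cong refl) blast
    then have "Q w v = 2 * real (deg v) * \<gamma>"
      using far[OF 5] by (simp add: Q_def deg_def)
    also have "\<dots> \<le> \<theta> * \<gamma>"
      using deg_far[of v] 5 \<gamma>_pos by (intro mult_right_mono) auto
    finally show ?thesis using far[OF 5] by simp
  qed
qed

lemma sum_T: "(\<Sum>x\<in>T. 1 + w x)
    = 2 * real (card centres) + (1 + \<beta>) * real (card paired)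
      + (1 + \<gamma>) * real (card (T - centres - paired))"
proof -
  have T: "T = (centres \<union> paired) \<union> (T - centres - paired)" using classes by blast
  have "(\<Sum>x\<in>T. 1 + w x) = (\<Sum>x\<in>centres \<union> paired. 1 + w x) + (\<Sum>x\<in>T - centres - paired. 1 + w x)"
    using finite_T by (subst T, intro sum.union_disjoint) auto
  also have "(\<Sum>x\<in>centres \<union> paired. 1 + w x) = (\<Sum>x\<in>centres. 1 + w x) + (\<Sum>x\<in>paired. 1 + w x)"
    using classes by (intro sum.union_disjoint) auto
  also have "(\<Sum>x\<in>centres. 1 + w x) = (\<Sum>x\<in>centres. 2)"
    by (rule sum.cong) (simp_all add: w_values)
  also have "(\<Sum>x\<in>paired. 1 + w x) = (\<Sum>x\<in>paired. 1 + \<beta>)"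
    by (rule sum.cong) (simp_all add: w_values)
  also have "(\<Sum>x\<in>T - centres - paired. 1 + w x) = (\<Sum>x\<in>T - centres - paired. 1 + \<gamma>)"
  proof (rule sum.cong[OF refl])
    fix x assume "x \<in> T - centres - paired"
    then have "x \<in> R - centres - leaves - paired" using classes by blast
    then show "1 + w x = 1 + \<gamma>" by (simp only: w_values(5))
  qed
  finally show ?thesis by (simp add: mult.commute)
qed

lemma card_classes: "real (card V) - real k = real (card centres) + real (card paired)
    + real (card (T - centres - paired)) + real (card leaves) + real (card (R - T - leaves))"
proof -
  have "card T = card centres + card paired + card (T - centres - paired)"
  proof -
    have "card T = card (centres \<union> paired) + card (T - (centres \<union> paired))"
      using classes finite_T by (metis Un_least card_Diff_subset card_mono finite_subset le_add_diff_inverse)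
    moreover have "card (centres \<union> paired) = card centres + card paired"
      using classes by (intro card_Un_disjoint) auto
    ultimately show ?thesis by (simp add: Diff_Diff_Int set_diff_eq conj_assoc)
  qed
  moreover have "card (R - T) = card leaves + card (R - T - leaves)"
    using classes by (metis card_Diff_subset card_mono finite_Diff finite_R finite_classes(3) le_add_diff_inverse)
  moreover have "card R = card T + card (R - T)"
    using classes by (metis card_Diff_subset card_mono finite_R finite_T le_add_diff_inverse)
  moreover have "card R + k = card V" using card_R card_hubs by simp
  ultimately show ?thesis by linarith
qed

text \<open>Pure algebra with the cardinalities replaced by reals: \<open>z\<close>,
  \<open>p\<close>, \<open>r\<close>, \<open>l\<close>, \<open>f\<close> count centres, paired
  vertices, isolated vertices of \<open>T\<close>, leaves and far vertices; \<open>d\<close> counts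
  hub neighbours, \<open>s\<close> is the missing part of \<open>T\<close>, and \<open>q\<close> is
  the value of \<open>Q\<close> at the hub.\<close>

lemma loss_identity:
  fixes p q r s z l f :: real
  assumes "\<theta> = 2 * (real k - 1) + (z + p + r + l + f) * (1 + \<gamma>) + \<tau>"
    and "q = 2 * d + (2 * z + (1 + \<beta>) * p + (1 + \<gamma>) * r) - s"
  shows "\<theta> * 1 - q = 2 * (real k - 1 - d) + s + (\<tau> - p * (\<beta> - \<gamma>))
    + ((z + l) * (1 + \<gamma>) - 2 * z) + f * (1 + \<gamma>)"
  unfolding assms(2) by (subst assms(1)) (simp add: algebra_simps)

text \<open>The loss at a hub, split into the missing hubs, the missing part of \<open>T\<close>, the surplus of
  \<open>\<tau>\<close>, the star leaves, and the vertices far from all hubs.\<close>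

lemma Q_w_hub:
  assumes h: "h \<in> hubs"
  shows "\<theta> * w h - Q w h = 2 * (real k - 1 - real (card (nbs h \<inter> hubs)))
    + (\<Sum>x\<in>T - nbs h. 1 + w x) + (\<tau> - real (card paired) * (\<beta> - \<gamma>))
    + ((real (card centres) + real (card leaves)) * (1 + \<gamma>) - 2 * real (card centres))
    + real (card (R - T - leaves)) * (1 + \<gamma>)"
proof -
  have "nbs h \<inter> R = T \<inter> nbs h" using h by (auto simp: T_def nbs_commute)
  moreover have "(\<Sum>x\<in>T. 1 + w x) = (\<Sum>x\<in>T \<inter> nbs h. 1 + w x) + (\<Sum>x\<in>T - nbs h. 1 + w x)"
    using finite_T by (rule sum.Int_Diff)
  moreover have "Q w h = 2 * real (card (nbs h \<inter> hubs)) + (\<Sum>x\<in>nbs h \<inter> R. 1 + w x)"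
    unfolding Q_w w_values(1)[OF h] by (simp add: sum.distrib)
  ultimately have "Q w h = 2 * real (card (nbs h \<inter> hubs)) + (\<Sum>x\<in>T. 1 + w x)
      - (\<Sum>x\<in>T - nbs h. 1 + w x)"
    by simp
  then show ?thesis
    unfolding w_values(1)[OF h] sum_T by (rule loss_identity[OF \<theta>_eq[unfolded card_classes]])
qed

lemma Q_w_hub_terms:
  assumes h: "h \<in> hubs"
  shows "0 \<le> real k - 1 - real (card (nbs h \<inter> hubs))"
    and "0 \<le> (\<Sum>x\<in>T - nbs h. 1 + w x)" and "0 \<le> \<tau> - real (card paired) * (\<beta> - \<gamma>)"
    and "real (card leaves) * \<gamma> \<le> (real (card centres) + real (card leaves)) * (1 + \<gamma>) - 2 * real (card centres)"
    and "0 \<le> real (card (R - T - leaves)) * (1 + \<gamma>)"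
proof -
  show "0 \<le> real k - 1 - real (card (nbs h \<inter> hubs))"
    using card_nbs_hub_le[OF h] k_pos by linarith
  show "0 \<le> (\<Sum>x\<in>T - nbs h. 1 + w x)"
    using w_pos by (intro sum_nonneg) (simp add: less_imp_le add_nonneg_nonneg)
  show "0 \<le> \<tau> - real (card paired) * (\<beta> - \<gamma>)" using \<tau> by simp
  have "0 \<le> real (card centres) * \<gamma>" using \<gamma>_pos by simp
  then show "real (card leaves) * \<gamma> \<le> (real (card centres) + real (card leaves)) * (1 + \<gamma>) - 2 * real (card centres)"
    using card_centres_le by (simp add: algebra_simps)
  show "0 \<le> real (card (R - T - leaves)) * (1 + \<gamma>)" using \<gamma>_pos by simp
qed

lemma nonneg_sum_split:
  fixes a b c d e f g :: real
  assumes "d = 2 * a + b + c + e + f" "0 \<le> a" "0 \<le> b" "0 \<le> c" "g \<le> e" "0 \<le> f" "0 \<le> g"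
  shows "0 \<le> d" and "d = 0 \<Longrightarrow> a = 0 \<and> b = 0 \<and> c = 0 \<and> g = 0 \<and> f = 0"
  using assms by linarith+

lemma leaves_\<gamma>: "0 \<le> real (card leaves) * \<gamma>"
  using \<gamma>_pos by simp

lemma Q_w_le: "v \<in> V \<Longrightarrow> Q w v \<le> \<theta> * w v"
proof (cases "v \<in> hubs")
  case True
  then show ?thesis
    using nonneg_sum_split(1)[OF Q_w_hub Q_w_hub_terms leaves_\<gamma>] by simp
qed (use Q_w_R in blast)

lemma Q_w_hub_tight:
  assumes h: "h \<in> hubs" and eq: "Q w h = \<theta> * w h"
  shows "nbs h = V - {h}" and "R = T" and "real (card paired) * (\<beta> - \<gamma>) = \<tau>"
proof -
  have zero: "real k - 1 - real (card (nbs h \<inter> hubs)) = 0" "(\<Sum>x\<in>T - nbs h. 1 + w x) = 0"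
    "\<tau> - real (card paired) * (\<beta> - \<gamma>) = 0" "real (card leaves) * \<gamma> = 0"
    "real (card (R - T - leaves)) * (1 + \<gamma>) = 0"
    using nonneg_sum_split(2)[OF Q_w_hub[OF h] Q_w_hub_terms[OF h] leaves_\<gamma>] eq by auto
  then show "real (card paired) * (\<beta> - \<gamma>) = \<tau>" by simp
  have "leaves = {}" using zero(4) \<gamma>_pos by simp
  moreover have "R - T - leaves = {}" using zero(5) \<gamma>_pos by simp
  ultimately show RT: "R = T" using classes by blast
  have "T - nbs h = {}"
  proof (rule ccontr)
    assume "T - nbs h \<noteq> {}"
    then have "0 < (\<Sum>x\<in>T - nbs h. 1 + w x)"
      using w_pos finite_T by (intro sum_pos) (auto intro: add_pos_pos)
    then show False using zero(2) by simp
  qed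
  moreover have "nbs h \<inter> hubs = hubs - {h}"
  proof (rule card_subset_eq)
    have "real (card (nbs h \<inter> hubs)) = real k - 1" using zero(1) by simp
    then show "card (nbs h \<inter> hubs) = card (hubs - {h})"
      using h card_hubs by simp
  qed auto
  ultimately show "nbs h = V - {h}" using RT hubs_subset nbs_subset[of h] by auto
qed

text \<open>Equality at a hub needs \<open>y\<close> nonzero there. A zero of the nonnegative
  eigenfunction spreads to all neighbours, so one zero hub makes all hubs zero through common
  neighbours, and then all of \<open>T\<close>. The maximal vertex \<open>u\<close> would be far
  from the hubs, where degrees are below \<theta>/2.\<close>

lemma tight: "\<mu> = \<theta>" "\<And>h. h \<in> hubs \<Longrightarrow> Q w h = \<theta> * w h"
proof -
  have "\<forall>v\<in>V. 0 \<le> y v" "\<forall>v\<in>V. \<mu> * y v \<le> Q y v" "\<forall>v\<in>V. 0 < w v"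
      "\<forall>v\<in>V. Q w v \<le> \<theta> * w v" "0 < y u"
    using y_nonneg subeigen w_pos Q_w_le y_u by (simp_all add: Q_def)
  note cmp = comparison[OF this(1-4) u_in_V this(5) \<theta>_le]
  show eq: "\<mu> = \<theta>" by (rule cmp(1))
  have zero_nbs: "y x = 0" if "v \<in> V" "y v = 0" "x \<in> nbs v" for v x
  proof -
    have "(\<Sum>x\<in>nbs v. y x) = 0" using cmp(2)[OF that(1)] that(2) by (simp add: Q_def)
    then show ?thesis
      using that(3) y_nonneg nbs_in_V(2) by (subst (asm) sum_nonneg_eq_0_iff) auto
  qed
  show "Q w h = \<theta> * w h" if h: "h \<in> hubs" for h
  proof (rule cmp(3))
    show "h \<in> V" using h hubs_subset by auto
    show "y h \<noteq> 0"
    proof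
      assume yh: "y h = 0"
      have hubs0: "y h' = 0" if h': "h' \<in> hubs" for h'
      proof -
        have "nbs h \<inter> nbs h' \<noteq> {}" using card_common_nbs[OF h h'] by auto
        then obtain x where x: "x \<in> nbs h" "h' \<in> nbs x" using nbs_commute by blast
        then have "y x = 0" using zero_nbs[OF \<open>h \<in> V\<close> yh] by blast
        then show ?thesis using zero_nbs[of x h'] x nbs_in_V by blast
      qed
      have "y v = 0" if "v \<in> T" for v
      proof -
        obtain h' where "h' \<in> hubs" "v \<in> nbs h'" using \<open>v \<in> T\<close> nbs_commute by (auto simp: T_def)
        then show ?thesis using zero_nbs[of h' v] hubs0 hubs_subset by blast
      qed
      then have "u \<in> R - T" using hubs0 u_in_V y_u by force
      then show False using deg_far[of u] two_deg_u eq by simp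
    qed
  qed
qed

end

text \<open>Without a path on \<open>2 * k + 2\<close> vertices, already an edge from
  \<open>T\<close> to a non-hub is impossible, so there are no single edges and \<tau> = 0 is
  admissible.\<close>

theorem extremal_S:
  assumes no_path': "\<And>p. path p \<Longrightarrow> length p \<noteq> 2 * k + 2"
    and "\<theta> \<le> \<mu>" "\<theta> \<ge> real (card V) + 2 * real k - 16 / 7"
    and "\<theta> = 2 * (real k - 1) + (real (card V) - real k) * (1 + real k / (\<theta> - real k))"
  shows "\<And>h. h \<in> hubs \<Longrightarrow> nbs h = V - {h}" and "\<And>v. v \<in> V - hubs \<Longrightarrow> nbs v = hubs"
proof -
  have T_nbs: "nbs v \<inter> R = {}" if v: "v \<in> T" for v
  proof (rule ccontr)
    assume "\<not> ?thesis"
    then obtain b where b: "b \<in> nbs v" "b \<in> R" by auto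
    obtain h where h: "h \<in> nbs v" "h \<in> hubs" using v by (auto simp: T_def)
    have "path [b, v, h]"
      using b h v hubs_subset nbs_commute by (auto simp: path_Cons T_def)
    moreover have "set [b, v, h] \<inter> hubs = {last [b, v, h]}"
      using b h v by (auto simp: T_def)
    moreover have "length [b, v, h] + 2 * card hubs \<le> 2 * k + 4"
      using card_hubs by simp
    ultimately obtain q where "path q" "length q = length [b, v, h] + 2 * card hubs - 1"
      using hub_extend[of "[b, v, h]"] by blast
    then show False using no_path'[of q] card_hubs by simp
  qed
  have "paired = {}" using T_nbs by (auto simp: paired_def T_def)
  define \<gamma> where "\<gamma> = real k / (\<theta> - real k)"
  \<comment> \<open>The value 1 of \<beta> is a placeholder, as no vertex is paired.\<close>
  have p: "\<forall>v\<in>paired. real (card (nbs v \<inter> hubs)) + (real (card (nbs v \<inter> hubs)) + 2) * 1 \<le> \<theta> * 1"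
    and \<tau>: "real (card paired) * (1 - \<gamma>) \<le> 0"
    using \<open>paired = {}\<close> by auto
  have eq: "\<theta> = 2 * (real k - 1) + (real (card V) - real k) * (1 + \<gamma>) + 0"
    using assms(4) by (simp add: \<gamma>_def)
  have one: "0 < (1::real)" by simp
  note ctx = assms(2,3) eq \<gamma>_def one p \<tau>
  note full = Q_w_hub_tight[OF ctx _ tight(2)[OF ctx]]
  show nbs_hub: "nbs h = V - {h}" if "h \<in> hubs" for h by (rule full(1)[OF that that])
  obtain h where h: "h \<in> hubs" by (rule obtain_hub)
  have "R = T" by (rule full(2)[OF h h])
  show "nbs v = hubs" if v: "v \<in> V - hubs" for v
  proof
    show "nbs v \<subseteq> hubs" using T_nbs[of v] v \<open>R = T\<close> nbs_subset[of v] by blast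
    show "hubs \<subseteq> nbs v" using nbs_hub v nbs_commute by blast
  qed
qed

text \<open>The allowance 2(\<beta> - \<gamma>) covers one single edge. If there were more,
  \<open>hub_unique\<close> would leave each paired vertex only one hub, and the comparison with the
  smaller root \<theta>' would apply. With at most one edge, equality at a hub forces exactly
  one.\<close>

theorem extremal_S_plus:
  assumes "\<theta> \<le> \<mu>" "\<theta>' \<ge> real (card V) + 2 * real k - 16 / 7" "\<theta>' < \<theta>"
    and eq': "\<theta>' = 2 * (real k - 1) + (real (card V) - real k) * (1 + real k / (\<theta>' - real k))"
    and eq: "\<theta> = 2 * (real k - 1) + (real (card V) - real k) * (1 + real k / (\<theta> - real k))
      + 2 * (real k / (\<theta> - real k - 2) - real k / (\<theta> - real k))"
  shows "\<And>h. h \<in> hubs \<Longrightarrow> nbs h = V - {h}"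
    and "\<exists>a b. a \<in> V - hubs \<and> b \<in> V - hubs \<and> a \<noteq> b \<and> nbs a = insert b hubs \<and> nbs b = insert a hubs
      \<and> (\<forall>v\<in>V - hubs - {a, b}. nbs v = hubs)"
proof -
  define \<gamma> \<beta> where "\<gamma> = real k / (\<theta> - real k)" and "\<beta> = real k / (\<theta> - real k - 2)"
  have n: "real (card V) \<ge> 7 * real k"
  proof -
    have "real k \<le> real k * real k" using k_pos by simp
    then show ?thesis using card_V_ge by linarith
  qed
  have big: "\<theta>' > 3 + real k" "\<theta> > 3 + real k"
    using n assms(2,3) k_pos by linarith+
  have less: "\<gamma> < \<beta>" unfolding \<gamma>_def \<beta>_def using big k_pos by (intro divide_strict_left_mono) auto
  have few: "card paired \<le> 2"
  proof (rule ccontr)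
    assume many: "\<not> ?thesis"
    have unique: "k \<noteq> 1 \<and> card (nbs v \<inter> hubs) \<le> 1" if v: "v \<in> paired" for v
    proof -
      obtain b where b: "b \<in> paired" "nbs v \<inter> R = {b}" "nbs b \<inter> R = {v}" using paired_nbs[OF v] .
      have "card {v, b} \<le> 2" by (simp add: card_insert_if)
      then have "\<not> paired \<subseteq> {v, b}" using many card_mono[of "{v, b}" paired] by auto
      then obtain c where c: "c \<in> paired" "c \<noteq> v" "c \<noteq> b" by blast
      obtain d where d: "d \<in> paired" "nbs c \<inter> R = {d}" "nbs d \<inter> R = {c}" using paired_nbs[OF c(1)] .
      have disj: "{v, b} \<inter> {c, d} = {}" using b c d by auto
      obtain h' where h': "h' \<in> nbs c \<inter> hubs" using c(1) by (auto simp: paired_def T_def)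
      have R: "v \<in> R" "b \<in> R" "c \<in> R" "d \<in> R" using v b c d by (auto simp: paired_def T_def)
      have "b \<in> nbs v" "d \<in> nbs c" using b d by auto
      note hu = hub_unique[OF R(1,2) this(1) R(3,4) this(2) disj _ h']
      obtain h where "h \<in> nbs v \<inter> hubs" using v by (auto simp: paired_def T_def)
      then have "k \<noteq> 1" by (rule hu(1))
      moreover have "nbs v \<inter> hubs \<subseteq> {h'}" using hu(2) by blast
      then have "card (nbs v \<inter> hubs) \<le> 1" using card_mono[of "{h'}"] by fastforce
      ultimately show ?thesis by simp
    qed
    have "paired \<noteq> {}" using many by auto
    then have k2: "real k \<ge> 2" using unique k_pos by fastforce
    define \<gamma>' where "\<gamma>' = real k / (\<theta>' - real k)"
    have \<gamma>': "\<gamma>' > 0" "(\<theta>' - real k) * \<gamma>' = real k"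
      using big k_pos by (simp_all add: \<gamma>'_def)
    \<comment> \<open>This is the condition \<open>paired_ok\<close> for a paired vertex with one
      hub neighbour and weight \<gamma>'; it needs \<open>k \<ge> 2\<close>.\<close>
    have "(\<theta>' - 3) * \<gamma>' \<ge> 1"
    proof -
      have "(real k - 1) * \<theta>' \<ge> (real k - 1) * 4"
        using big k_pos by (intro mult_left_mono) auto
      then have "\<theta>' - real k \<le> real k * (\<theta>' - 3)" using k2 by (simp add: algebra_simps)
      then show ?thesis using big by (simp add: \<gamma>'_def field_simps)
    qed
    then have g: "1 + 3 * \<gamma>' \<le> \<theta>' * \<gamma>'" by (simp add: algebra_simps)
    have p: "\<forall>v\<in>paired.
        real (card (nbs v \<inter> hubs)) + (real (card (nbs v \<inter> hubs)) + 2) * \<gamma>' \<le> \<theta>' * \<gamma>'"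
    proof
      fix v assume "v \<in> paired"
      then have "real (card (nbs v \<inter> hubs)) \<le> 1" using unique by simp
      then have "real (card (nbs v \<inter> hubs)) + (real (card (nbs v \<inter> hubs)) + 2) * \<gamma>' \<le> 1 + (1 + 2) * \<gamma>'"
        using \<gamma>' by (intro add_mono mult_right_mono) auto
      then show "real (card (nbs v \<inter> hubs)) + (real (card (nbs v \<inter> hubs)) + 2) * \<gamma>' \<le> \<theta>' * \<gamma>'"
        using g by simp
    qed
    \<comment> \<open>Paired vertices get the ordinary weight \<gamma>', so they add nothing and
      \<tau> = 0 works; but \<theta>' < \<theta> \<le> \<mu>.\<close>
    have "\<mu> = \<theta>'"
      by (rule tight(1)[where \<gamma> = \<gamma>' and \<beta> = \<gamma>' and \<tau> = 0])
        (use assms eq' p \<gamma>' in \<open>auto simp: \<gamma>'_def\<close>)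
    then show False using assms by simp
  qed
  have \<beta>: "\<beta> > 0" "(\<theta> - real k - 2) * \<beta> = real k" using big k_pos by (simp_all add: \<beta>_def)
  have p: "\<forall>v\<in>paired. real (card (nbs v \<inter> hubs)) + (real (card (nbs v \<inter> hubs)) + 2) * \<beta> \<le> \<theta> * \<beta>"
  proof
    fix v assume "v \<in> paired"
    have "real (card (nbs v \<inter> hubs)) \<le> real k" using card_nbs_hubs_le card_hubs by simp
    then have "real (card (nbs v \<inter> hubs)) + (real (card (nbs v \<inter> hubs)) + 2) * \<beta> \<le> real k + (real k + 2) * \<beta>"
      using \<beta> by (intro add_mono mult_right_mono) auto
    also have "\<dots> = \<theta> * \<beta>" using \<beta>(2) by (simp add: algebra_simps)
    finally show "real (card (nbs v \<inter> hubs)) + (real (card (nbs v \<inter> hubs)) + 2) * \<beta> \<le> \<theta> * \<beta>" .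
  qed
  have \<tau>: "real (card paired) * (\<beta> - \<gamma>) \<le> 2 * (\<beta> - \<gamma>)"
    using few less by (intro mult_right_mono) auto
  have ge: "\<theta> \<ge> real (card V) + 2 * real k - 16 / 7" using assms by simp
  note ctx = assms(1) ge eq[folded \<gamma>_def \<beta>_def] \<gamma>_def \<beta>(1) p \<tau>
  note full = Q_w_hub_tight[OF ctx _ tight(2)[OF ctx]]
  show nbs_hub: "nbs h = V - {h}" if "h \<in> hubs" for h by (rule full(1)[OF that that])
  obtain h where h: "h \<in> hubs" by (rule obtain_hub)
  have RT: "R = T" by (rule full(2)[OF h h])
  have "real (card paired) * (\<beta> - \<gamma>) = 2 * (\<beta> - \<gamma>)" by (rule full(3)[OF h h])
  then have "(real (card paired) - 2) * (\<beta> - \<gamma>) = 0" by (simp add: left_diff_distrib)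
  then have card2: "card paired = 2" using less by simp
  have nbs_R: "nbs v = hubs \<union> (nbs v \<inter> R)" if "v \<in> R" for v
    using nbs_hub that nbs_commute[of _ v] nbs_split[of v] by blast
  obtain a where a: "a \<in> paired" using card2 by fastforce
  obtain b where b: "b \<in> paired" "nbs a \<inter> R = {b}" "nbs b \<inter> R = {a}" using paired_nbs[OF a] .
  have ab: "a \<noteq> b" using b(2) by auto
  have "paired = {a, b}"
    using card_subset_eq[of paired "{a, b}"] a b(1) card2 ab by auto
  have aR: "a \<in> R" "b \<in> R" using a b(1) by (auto simp: paired_def T_def)
  moreover have "nbs v = hubs" if v: "v \<in> V - hubs - {a, b}" for v
  proof -
    have "v \<in> T" "v \<notin> paired" using v RT \<open>paired = {a, b}\<close> by auto
    then have "nbs v \<inter> T = {}" by (auto simp: paired_def)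
    then show ?thesis using nbs_R[of v] v RT by simp
  qed
  moreover have "nbs a = insert b hubs" "nbs b = insert a hubs"
    using nbs_R[OF aR(1)] nbs_R[OF aR(2)] b by auto
  ultimately show "\<exists>a b. a \<in> V - hubs \<and> b \<in> V - hubs \<and> a \<noteq> b \<and> nbs a = insert b hubs
      \<and> nbs b = insert a hubs \<and> (\<forall>v\<in>V - hubs - {a, b}. nbs v = hubs)"
    using ab by blast
qed

end

section \<open>The largest root and the Q-index\<close>

text \<open>The equation at a clique vertex of weight 1, with K/(\<theta> - K) on the other vertices
  and K/(\<theta> - K - 2) on the ends of an added edge. The parameter \<open>t\<close> counts these
  ends, 0 for \<open>S_graph\<close> and 2 for \<open>S_plus_graph\<close>. The root comes from the
  intermediate value theorem.\<close>

lemma root_exists: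
  fixes K N t :: real
  assumes K: "K = 1 \<or> K \<ge> 2" and N: "N \<ge> 7 * K * K" and t: "0 \<le> t" "t \<le> 2"
  obtains \<theta> where "\<theta> \<ge> N + 2 * K - 16 / 7" "K = 1 \<Longrightarrow> \<theta> \<ge> N"
    "\<theta> = 2 * (K - 1) + (N - K) * (1 + K / (\<theta> - K)) + t * (K / (\<theta> - K - 2) - K / (\<theta> - K))"
proof -
  define f where "f x = x - (2 * (K - 1) + (N - K) * (1 + K / (x - K)) + t * (K / (x - K - 2) - K / (x - K)))" for x
  define a where "a = (if K = 1 then N else N + 2 * K - 16 / 7)"
  have "K * 1 \<le> K * K" using K by (intro mult_left_mono) auto
  then have N7: "N \<ge> 7 * K" using N by linarith
  have a: "a > K + 2" "a \<le> 2 * N" "a \<ge> N + 2 * K - 16 / 7" "K = 1 \<Longrightarrow> a \<ge> N"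
    using K N7 by (auto simp: a_def)
  have frac: "K / (x - K) \<le> K / (x - K - 2)" if "x > K + 2" for x
    using that K by (intro divide_left_mono) auto
  \<comment> \<open>For \<open>K \<ge> 2\<close> the expanded inequality contains
    \<open>2 * K * K\<close> on the left and \<open>2 / 7 * N\<close> on the right, and
    \<open>N \<ge> 7 * K * K\<close> balances them: the origin of 16/7. For \<open>K = 1\<close>
    both sides are \<open>N - 1\<close>.\<close>
  have "(a - N - K + 2) * (a - K) \<le> (N - K) * K"
    using K N by (auto simp: a_def algebra_simps)
  then have "a - N - K + 2 \<le> (N - K) * K / (a - K)"
    using a by (simp add: pos_le_divide_eq)
  moreover have "0 \<le> t * (K / (a - K - 2) - K / (a - K))"
    using frac[OF a(1)] t by (intro mult_nonneg_nonneg) auto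
  ultimately have fa: "f a \<le> 0" by (simp add: f_def algebra_simps)
  have big: "2 * N > K + 2" using a by linarith
  have frac1: "K / (2 * N - K) \<le> 1" "K / (2 * N - K - 2) \<le> 1" "0 \<le> K / (2 * N - K)"
    using big N7 K by (auto simp: divide_simps)
  have "(N - K) * (1 + K / (2 * N - K)) \<le> (N - K) * 2"
    using N7 K frac1 by (intro mult_left_mono) auto
  moreover have "t * (K / (2 * N - K - 2) - K / (2 * N - K)) \<le> 2 * 1"
  proof (rule mult_mono)
    show "K / (2 * N - K - 2) - K / (2 * N - K) \<le> 1" using frac1 by linarith
    show "0 \<le> K / (2 * N - K - 2) - K / (2 * N - K)" using frac[OF big] by linarith
  qed (use t in auto)
  ultimately have "2 * (K - 1) + (N - K) * (1 + K / (2 * N - K))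
      + t * (K / (2 * N - K - 2) - K / (2 * N - K)) \<le> 2 * (K - 1) + (N - K) * 2 + 2 * 1"
    by (intro add_mono) auto
  \<comment> \<open>The upper bound just obtained adds up to exactly \<open>2 * N\<close>.\<close>
  then have fb: "0 \<le> f (2 * N)" by (simp add: f_def)
  have "continuous_on {a..2 * N} f"
    unfolding f_def using a(1) by (intro continuous_intros) auto
  then obtain \<theta> where "a \<le> \<theta>" "f \<theta> = 0"
    using IVT'[of f a 0 "2 * N"] fa fb a(2) by blast
  then show ?thesis
    using a by (intro that[of \<theta>]) (auto simp: f_def)
qed

text \<open>If \<theta> \<le> \<theta>', the fractions at \<theta> are at least those at \<theta>',
  and the term of the added edge is strictly positive, so the right side at \<theta> would be
  larger.\<close>

lemma root_strict_mono:
  fixes K N \<theta> \<theta>' :: real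
  assumes K: "K \<ge> 1" "N > K" and big: "\<theta> > K + 2" "\<theta>' > K + 2"
    and eq': "\<theta>' = 2 * (K - 1) + (N - K) * (1 + K / (\<theta>' - K))"
    and eq: "\<theta> = 2 * (K - 1) + (N - K) * (1 + K / (\<theta> - K)) + 2 * (K / (\<theta> - K - 2) - K / (\<theta> - K))"
  shows "\<theta>' < \<theta>"
proof (rule ccontr)
  assume not_less: "\<not> \<theta>' < \<theta>"
  then have "K / (\<theta>' - K) \<le> K / (\<theta> - K)"
    using K big by (intro divide_left_mono mult_pos_pos) auto
  then have "(N - K) * (1 + K / (\<theta>' - K)) \<le> (N - K) * (1 + K / (\<theta> - K))"
    using K by (intro mult_left_mono) auto
  moreover have "K / (\<theta> - K) < K / (\<theta> - K - 2)"
    using K big by (intro divide_strict_left_mono mult_pos_pos) auto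
  ultimately have "2 * (K - 1) + (N - K) * (1 + K / (\<theta>' - K)) + 0
      < 2 * (K - 1) + (N - K) * (1 + K / (\<theta> - K)) + 2 * (K / (\<theta> - K - 2) - K / (\<theta> - K))"
    by (intro add_le_less_mono add_left_mono) auto
  then have "\<theta>' < \<theta>" using eq eq' by simp
  then show False using not_less by contradiction
qed

lemma simple_graph_of_pair_graph:
  assumes "pair_graph G"
  shows "simple_graph (pverts G) (parcs G)"
proof -
  interpret pair_graph G by fact
  show ?thesis
    by standard (auto dest: wellformed' no_loops' arcs_symmetric intro: pair_finite_verts)
qed

section \<open>The spectrum of the signless Laplacian through functions on the vertices\<close>

context
  fixes G :: "'a pair_pre_digraph"
  assumes G: "pair_graph G"
begin

interpretation simple_graph "pverts G" "parcs G"
  by (rule simple_graph_of_pair_graph[OF G])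

private abbreviation (input) "nv \<equiv> card (pverts G)"
private abbreviation (input) "vtx \<equiv> from_nat_into (pverts G)"

lemma bij_enum: "bij_betw vtx {0..<nv} (pverts G)"
  using bij_betw_from_nat_into_finite[OF finite_V] by (simp add: atLeast0LessThan)

lemma enum_in: "i < nv \<Longrightarrow> vtx i \<in> pverts G"
  using bij_enum by (auto simp: bij_betw_def)

lemma enum_cases:
  assumes "v \<in> pverts G"
  obtains i where "i < nv" "v = vtx i"
proof -
  have "v \<in> vtx ` {0..<nv}" using assms bij_enum by (simp add: bij_betw_def)
  then show ?thesis using that by auto
qed

lemma out_degree_eq: "out_degree (with_proj G) v = deg v"
proof -
  have "out_arcs (with_proj G) v = Pair v ` nbs v"
    by (auto simp: out_arcs_def nbs_iff)
  then show ?thesis by (simp add: out_degree_def deg_def card_image inj_on_def)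
qed

lemma signless_laplacian_carrier: "signless_laplacian G \<in> carrier_mat nv nv"
  by (simp add: signless_laplacian_def Let_def)

lemma signless_laplacian_entry:
  assumes "i < nv" "j < nv"
  shows "signless_laplacian G $$ (i, j)
    = (if i = j then real (deg (vtx i)) else 0) + (if vtx j \<in> nbs (vtx i) then 1 else 0)"
  using assms by (simp add: signless_laplacian_def Let_def out_degree_eq nbs_iff)

lemma signless_laplacian_mult:
  "signless_laplacian G *\<^sub>v vec nv (\<lambda>i. f (vtx i)) = vec nv (\<lambda>i. Q f (vtx i))"
proof (rule eq_vecI)
  fix i assume "i < dim_vec (vec nv (\<lambda>i. Q f (vtx i)))"
  then have i: "i < nv" by simp
  have "(signless_laplacian G *\<^sub>v vec nv (\<lambda>i. f (vtx i))) $ i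
      = (\<Sum>j\<in>{0..<nv}. signless_laplacian G $$ (i, j) * f (vtx j))"
    using i signless_laplacian_carrier by (auto simp: mult_mat_vec_def scalar_prod_def intro!: sum.cong)
  also have "\<dots> = (\<Sum>j\<in>{0..<nv}. (if i = j then real (deg (vtx i)) * f (vtx i) else 0)
      + (if vtx j \<in> nbs (vtx i) then f (vtx j) else 0))"
    using i by (intro sum.cong) (auto simp: signless_laplacian_entry distrib_right)
  also have "\<dots> = real (deg (vtx i)) * f (vtx i)
      + (\<Sum>j\<in>{0..<nv}. if vtx j \<in> nbs (vtx i) then f (vtx j) else 0)"
    using i by (simp add: sum.distrib)
  also have "(\<Sum>j\<in>{0..<nv}. if vtx j \<in> nbs (vtx i) then f (vtx j) else 0)
      = (\<Sum>w\<in>pverts G. if w \<in> nbs (vtx i) then f w else 0)"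
    by (rule sum.reindex_bij_betw[OF bij_enum])
  also have "\<dots> = (\<Sum>w\<in>nbs (vtx i). f w)"
    using nbs_subset finite_V by (simp add: sum.inter_restrict[symmetric] Int_absorb1)
  finally show "(signless_laplacian G *\<^sub>v vec nv (\<lambda>i. f (vtx i))) $ i = vec nv (\<lambda>i. Q f (vtx i)) $ i"
    using i by (simp add: Q_def)
qed (use signless_laplacian_carrier in auto)

lemma vec_enum:
  assumes "x \<in> carrier_vec nv"
  obtains f where "x = vec nv (\<lambda>i. f (vtx i))"
proof
  show "x = vec nv (\<lambda>i. (\<lambda>v. x $ inv_into {0..<nv} vtx v) (vtx i))"
    using assms bij_enum by (intro eq_vecI) (auto simp: bij_betw_inv_into_left)
qed

lemma eigenvalue_signless_laplacian:
  "eigenvalue (signless_laplacian G) \<mu> \<longleftrightarrow>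
    (\<exists>f. (\<exists>v\<in>pverts G. f v \<noteq> 0) \<and> (\<forall>v\<in>pverts G. Q f v = \<mu> * f v))" (is "?L \<longleftrightarrow> ?R")
proof
  assume ?L
  then obtain x where x: "x \<in> carrier_vec nv" "x \<noteq> 0\<^sub>v nv" "signless_laplacian G *\<^sub>v x = \<mu> \<cdot>\<^sub>v x"
    using signless_laplacian_carrier by (auto simp: eigenvalue_def eigenvector_def)
  obtain f where f: "x = vec nv (\<lambda>i. f (vtx i))" by (rule vec_enum[OF x(1)])
  have eq: "Q f (vtx i) = \<mu> * f (vtx i)" if "i < nv" for i
    using arg_cong[OF x(3), of "\<lambda>x. x $ i"] that unfolding f signless_laplacian_mult by simp
  have "\<exists>v\<in>pverts G. f v \<noteq> 0"
  proof (rule ccontr)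
    assume "\<not> ?thesis"
    then have "x = 0\<^sub>v nv" using f enum_in by (intro eq_vecI) auto
    then show False using x(2) by simp
  qed
  moreover have "Q f v = \<mu> * f v" if v: "v \<in> pverts G" for v
  proof -
    obtain i where "i < nv" "v = vtx i" by (rule enum_cases[OF v])
    then show ?thesis using eq by simp
  qed
  ultimately show ?R by blast
next
  assume ?R
  then obtain f v where f: "v \<in> pverts G" "f v \<noteq> 0" "\<And>v. v \<in> pverts G \<Longrightarrow> Q f v = \<mu> * f v" by blast
  define x where "x = vec nv (\<lambda>i. f (vtx i))"
  obtain i where "i < nv" "v = vtx i" by (rule enum_cases[OF f(1)])
  then have "x $ i \<noteq> 0\<^sub>v nv $ i" using f(2) by (simp add: x_def)
  then have "x \<noteq> 0\<^sub>v nv" by metis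
  moreover have "signless_laplacian G *\<^sub>v x = \<mu> \<cdot>\<^sub>v x"
    unfolding x_def signless_laplacian_mult using f(3) enum_in by (intro eq_vecI) auto
  moreover have "x \<in> carrier_vec nv" by (simp add: x_def)
  ultimately have "eigenvector (signless_laplacian G) x \<mu>"
    using signless_laplacian_carrier by (simp add: eigenvector_def)
  then show ?L unfolding eigenvalue_def ..
qed

text \<open>A complex eigenvector \<open>g + \<i>h\<close> for \<open>a + \<i>b\<close> has \<open>Q g = a g - b h\<close> and
  \<open>Q h = b g + a h\<close>, and symmetry of \<open>Q\<close> forces \<open>b = 0\<close>.\<close>

lemma real_eigenvalue_exists:
  assumes "pverts G \<noteq> {}"
  shows "\<exists>\<mu>. eigenvalue (signless_laplacian G) \<mu>"
proof -
  define M where "M = map_mat complex_of_real (signless_laplacian G)"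
  have nv: "0 < nv" using assms finite_V by (simp add: card_gt_0_iff)
  have M: "M \<in> carrier_mat nv nv" using signless_laplacian_carrier by (simp add: M_def)
  obtain z where "eigenvalue M z" using spectrum_non_empty[OF M nv] by (auto simp: spectrum_def)
  then obtain x where x: "x \<in> carrier_vec nv" "x \<noteq> 0\<^sub>v nv" "M *\<^sub>v x = z \<cdot>\<^sub>v x"
    using M by (auto simp: eigenvalue_def eigenvector_def)
  define g where "g v = Re (x $ inv_into {0..<nv} vtx v)" for v
  define h where "h v = Im (x $ inv_into {0..<nv} vtx v)" for v
  have inv: "inv_into {0..<nv} vtx (vtx i) = i" if "i < nv" for i
    using bij_enum that by (simp add: bij_betw_inv_into_left)
  have entry: "(\<Sum>j\<in>{0..<nv}. complex_of_real (signless_laplacian G $$ (i, j)) * x $ j) = z * x $ i"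
    if i: "i < nv" for i
  proof -
    have "(M *\<^sub>v x) $ i = (\<Sum>j\<in>{0..<nv}. complex_of_real (signless_laplacian G $$ (i, j)) * x $ j)"
      using i x(1) signless_laplacian_carrier
      by (auto simp: M_def mult_mat_vec_def scalar_prod_def intro!: sum.cong)
    then show ?thesis using x(1,3) i by simp
  qed
  have mult: "(\<Sum>j\<in>{0..<nv}. signless_laplacian G $$ (i, j) * f (vtx j)) = Q f (vtx i)"
    if i: "i < nv" for f i
  proof -
    have "(signless_laplacian G *\<^sub>v vec nv (\<lambda>i. f (vtx i))) $ i
        = (\<Sum>j\<in>{0..<nv}. signless_laplacian G $$ (i, j) * f (vtx j))"
      using i signless_laplacian_carrier by (auto simp: mult_mat_vec_def scalar_prod_def intro!: sum.cong)
    then show ?thesis using i unfolding signless_laplacian_mult by simp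
  qed
  have "Q g (vtx i) = Re z * g (vtx i) - Im z * h (vtx i)"
    and "Q h (vtx i) = Im z * g (vtx i) + Re z * h (vtx i)" if i: "i < nv" for i
    using arg_cong[OF entry[OF i], of Re] arg_cong[OF entry[OF i], of Im] i
    by (simp_all add: mult[symmetric] g_def h_def inv)
  note enum_eqs = this
  have Qg: "Q g v = Re z * g v - Im z * h v" and Qh: "Q h v = Im z * g v + Re z * h v"
    if v: "v \<in> pverts G" for v
  proof -
    obtain i where "i < nv" "v = vtx i" by (rule enum_cases[OF v])
    then show "Q g v = Re z * g v - Im z * h v" "Q h v = Im z * g v + Re z * h v"
      using enum_eqs by simp_all
  qed
  obtain i where "i < nv" "x $ i \<noteq> 0" using x(1,2) by (metis carrier_vecD eq_vecI index_zero_vec)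
  then have nz: "g (vtx i) \<noteq> 0 \<or> h (vtx i) \<noteq> 0" "vtx i \<in> pverts G"
    using enum_in by (auto simp: g_def h_def inv complex_eq_iff)
  have "Im z = 0"
  proof -
    have "0 = (\<Sum>v\<in>pverts G. g v * Q h v) - (\<Sum>v\<in>pverts G. h v * Q g v)"
      using Q_symmetric[of g h] by simp
    also have "\<dots> = (\<Sum>v\<in>pverts G. Im z * ((g v)\<^sup>2 + (h v)\<^sup>2))"
      unfolding sum_subtractf[symmetric]
      by (rule sum.cong[OF refl], simp only: Qg Qh, simp add: algebra_simps power2_eq_square)
    also have "\<dots> = Im z * (\<Sum>v\<in>pverts G. (g v)\<^sup>2 + (h v)\<^sup>2)"
      by (rule sum_distrib_left[symmetric])
    finally have "Im z = 0 \<or> (\<Sum>v\<in>pverts G. (g v)\<^sup>2 + (h v)\<^sup>2) = 0" by simp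
    moreover have "(\<Sum>v\<in>pverts G. (g v)\<^sup>2 + (h v)\<^sup>2) > 0"
      using nz finite_V by (intro sum_pos2[of _ "vtx i"]) (auto simp: sum_power2_gt_zero_iff)
    ultimately show ?thesis by simp
  qed
  then have "\<forall>v\<in>pverts G. Q g v = Re z * g v" "\<forall>v\<in>pverts G. Q h v = Re z * h v"
    using Qg Qh by auto
  then show ?thesis
    using nz unfolding eigenvalue_signless_laplacian by blast
qed

lemma Q_index_eigenfunction:
  assumes "pverts G \<noteq> {}"
  obtains f v where "v \<in> pverts G" "f v \<noteq> 0" "\<forall>v\<in>pverts G. Q f v = Q_index G * f v"
proof -
  have "finite (spectrum (signless_laplacian G))"
    by (rule card_finite_spectrum(1)[OF signless_laplacian_carrier])
  moreover have "spectrum (signless_laplacian G) \<noteq> {}"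
    using real_eigenvalue_exists[OF assms] by (auto simp: spectrum_def)
  ultimately have "Q_index G \<in> spectrum (signless_laplacian G)"
    unfolding Q_index_def by (rule Max_in)
  then show ?thesis
    using that unfolding spectrum_def mem_Collect_eq eigenvalue_signless_laplacian by blast
qed

lemma Q_index_ge:
  assumes "v \<in> pverts G" "f v \<noteq> 0" "\<And>v. v \<in> pverts G \<Longrightarrow> Q f v = \<mu> * f v"
  shows "\<mu> \<le> Q_index G"
proof -
  have "\<mu> \<in> spectrum (signless_laplacian G)"
    unfolding spectrum_def mem_Collect_eq eigenvalue_signless_laplacian using assms by blast
  then show ?thesis
    unfolding Q_index_def using card_finite_spectrum(1)[OF signless_laplacian_carrier] by (rule Max_ge[rotated])
qed

lemma Q_index_subeigenfunction:
  assumes "pverts G \<noteq> {}"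
  obtains y u where "u \<in> pverts G" "y u = 1" "\<And>v. v \<in> pverts G \<Longrightarrow> 0 \<le> y v \<and> y v \<le> 1"
    "\<And>v. v \<in> pverts G \<Longrightarrow> Q_index G * y v \<le> real (deg v) * y v + (\<Sum>w\<in>nbs v. y w)"
proof -
  obtain f v0 where f: "v0 \<in> pverts G" "f v0 \<noteq> 0" "\<forall>v\<in>pverts G. Q f v = Q_index G * f v"
    by (rule Q_index_eigenfunction[OF assms])
  have "Max ((\<lambda>v. \<bar>f v\<bar>) ` pverts G) \<in> (\<lambda>v. \<bar>f v\<bar>) ` pverts G"
    using assms finite_V by (intro Max_in) auto
  then obtain u where u: "u \<in> pverts G" "Max ((\<lambda>v. \<bar>f v\<bar>) ` pverts G) = \<bar>f u\<bar>" by auto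
  have max: "\<bar>f v\<bar> \<le> \<bar>f u\<bar>" if "v \<in> pverts G" for v
    unfolding u(2)[symmetric] using that finite_V by (intro Max_ge) auto
  have pos: "\<bar>f u\<bar> > 0" using max[OF f(1)] f(2) by linarith
  show ?thesis
  proof (rule that[of u "\<lambda>v. \<bar>f v\<bar> / \<bar>f u\<bar>"])
    show "u \<in> pverts G" "\<bar>f u\<bar> / \<bar>f u\<bar> = 1" using u pos by auto
    fix v assume v: "v \<in> pverts G"
    show "0 \<le> \<bar>f v\<bar> / \<bar>f u\<bar> \<and> \<bar>f v\<bar> / \<bar>f u\<bar> \<le> 1" using max[OF v] pos by simp
    \<comment> \<open>This holds whatever the sign of \<open>Q_index G\<close>.\<close>
    have "Q_index G * \<bar>f v\<bar> \<le> \<bar>Q_index G * f v\<bar>"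
      by (simp add: abs_mult mult_right_mono)
    also have "\<dots> = \<bar>real (deg v) * f v + (\<Sum>w\<in>nbs v. f w)\<bar>"
      using bspec[OF f(3) v] by (simp add: Q_def)
    also have "\<dots> \<le> real (deg v) * \<bar>f v\<bar> + (\<Sum>w\<in>nbs v. \<bar>f w\<bar>)"
      by (rule order_trans[OF abs_triangle_ineq]) (simp add: abs_mult sum_abs)
    finally have "Q_index G * \<bar>f v\<bar> / \<bar>f u\<bar> \<le> (real (deg v) * \<bar>f v\<bar> + (\<Sum>w\<in>nbs v. \<bar>f w\<bar>)) / \<bar>f u\<bar>"
      using pos by (intro divide_right_mono) auto
    then show "Q_index G * (\<bar>f v\<bar> / \<bar>f u\<bar>) \<le> real (deg v) * (\<bar>f v\<bar> / \<bar>f u\<bar>) + (\<Sum>w\<in>nbs v. \<bar>f w\<bar> / \<bar>f u\<bar>)"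
      by (simp add: add_divide_distrib sum_divide_distrib)
  qed
qed

end

section \<open>Graphs up to isomorphism\<close>

text \<open>The bijection runs from the model graph \<open>H\<close> to \<open>G\<close>, the
  natural direction when \<open>H\<close> lives on numbers; the isomorphism record wants its inverse
  \<phi>, acting on an arc through both ends.\<close>

lemma graph_isoI:
  assumes G: "pair_graph G" and H: "pair_graph H"
    and bij: "bij_betw \<psi> (pverts H) (pverts G)"
    and arcs: "\<And>a b. a \<in> pverts H \<Longrightarrow> b \<in> pverts H \<Longrightarrow> (a, b) \<in> parcs H \<longleftrightarrow> (\<psi> a, \<psi> b) \<in> parcs G"
  shows "graph_iso G H"
proof -
  interpret G: pair_graph G by fact
  interpret H: pair_graph H by fact
  define \<phi> where "\<phi> = the_inv_into (pverts H) \<psi>"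
  have bij': "bij_betw \<phi> (pverts G) (pverts H)"
    unfolding \<phi>_def by (rule bij_betw_the_inv_into[OF bij])
  have inv: "\<phi> (\<psi> a) = a" if "a \<in> pverts H" for a
    using bij that by (simp add: \<phi>_def the_inv_into_f_f bij_betw_def)
  define f where "f = \<lparr> iso_verts = \<phi>, iso_arcs = map_prod \<phi> \<phi>, iso_head = snd, iso_tail = fst \<rparr>"
  have "inj_on (map_prod \<phi> \<phi>) (pverts G \<times> pverts G)"
    using bij' by (intro map_prod_inj_on) (auto simp: bij_betw_def)
  moreover have "parcs G \<subseteq> pverts G \<times> pverts G"
    using G.wellformed' by auto
  ultimately have "inj_on (map_prod \<phi> \<phi>) (parcs G)" by (rule inj_on_subset)
  then have "pre_digraph.digraph_isomorphism (with_proj G) f"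
    using bij' G.wf_digraph_axioms by (simp add: pre_digraph.digraph_isomorphism_def f_def bij_betw_def)
  moreover have "with_proj H = app_iso f (with_proj G)"
  proof (rule pre_digraph.equality)
    show "verts (with_proj H) = verts (app_iso f (with_proj G))"
      using bij' by (simp add: f_def bij_betw_def)
    have "parcs H = map_prod \<phi> \<phi> ` parcs G"
    proof (intro equalityI subsetI)
      fix e assume e: "e \<in> parcs H"
      then obtain a b where ab: "e = (a, b)" "a \<in> pverts H" "b \<in> pverts H"
        using H.wellformed' by (cases e) auto
      then have "(\<psi> a, \<psi> b) \<in> parcs G" "e = map_prod \<phi> \<phi> (\<psi> a, \<psi> b)"
        using arcs e inv by auto
      then show "e \<in> map_prod \<phi> \<phi> ` parcs G" by blast
    next
      fix e assume "e \<in> map_prod \<phi> \<phi> ` parcs G"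
      then obtain x z where xz: "(x, z) \<in> parcs G" "e = (\<phi> x, \<phi> z)" by auto
      then have "x \<in> pverts G" "z \<in> pverts G" using G.wellformed' by auto
      then have "x \<in> \<psi> ` pverts H" "z \<in> \<psi> ` pverts H"
        using bij by (simp_all add: bij_betw_def)
      then obtain a b where "a \<in> pverts H" "b \<in> pverts H" "x = \<psi> a" "z = \<psi> b" by auto
      then show "e \<in> parcs H" using arcs xz inv by auto
    qed
    then show "arcs (with_proj H) = arcs (app_iso f (with_proj G))" by (simp add: f_def)
  qed (simp_all add: f_def)
  ultimately show ?thesis unfolding graph_iso_def digraph_iso_def by blast
qed

lemma pair_graph_path_graph: "pair_graph (path_graph l)"
proof -
  have "parcs (path_graph l) \<subseteq> {0..<l} \<times> {0..<l}" by (auto simp: path_graph_def)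
  then have "finite (parcs (path_graph l))" by (rule finite_subset) simp
  then show ?thesis
    by unfold_locales (auto simp: path_graph_def symmetric_def intro!: symI)
qed

lemma contains_path_graph:
  assumes G: "pair_graph G" and p: "simple_graph.path (pverts G) (parcs G) p"
  shows "contains_subgraph G (path_graph (length p))"
proof -
  interpret pair_graph G by fact
  interpret simple_graph "pverts G" "parcs G" by (rule simple_graph_of_pair_graph[OF G])
  have dist: "distinct p" and sub: "set p \<subseteq> pverts G"
    and step: "successively (\<lambda>x y. (x, y) \<in> parcs G) p"
    using p by (auto simp: path_def)
  have bij: "bij_betw (nth p) {0..<length p} (set p)"
    using bij_betw_nth[OF dist] by (simp add: atLeast0LessThan)
  \<comment> \<open>Only consecutive vertices are joined, since the vertices of \<open>p\<close> may
    span further edges of \<open>G\<close>.\<close>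
  define H where "H = \<lparr> pverts = set p,
    parcs = map_prod (nth p) (nth p) ` parcs (path_graph (length p)) \<rparr>"
  interpret P: pair_graph "path_graph (length p)" by (rule pair_graph_path_graph)
  have arc_iff: "(i, j) \<in> parcs (path_graph (length p)) \<longleftrightarrow> (p ! i, p ! j) \<in> parcs H"
    if "i < length p" "j < length p" for i j
  proof
    assume "(p ! i, p ! j) \<in> parcs H"
    then obtain i' j' where ij: "(i', j') \<in> parcs (path_graph (length p))" "p ! i = p ! i'" "p ! j = p ! j'"
      by (auto simp: H_def)
    then have "i' < length p" "j' < length p" by (auto simp: path_graph_def)
    then show "(i, j) \<in> parcs (path_graph (length p))"
      using ij that dist by (simp add: nth_eq_iff_index_eq)
  qed (force simp: H_def)
  have parcs_H: "parcs H \<subseteq> parcs G"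
  proof -
    have "(p ! i, p ! Suc i) \<in> parcs G" if "Suc i < length p" for i
      using step that by (simp add: successively_conv_nth)
    then show ?thesis using E_sym by (auto simp: H_def path_graph_def)
  qed
  have H: "pair_graph H"
  proof
    show "finite (pverts H)" "finite (parcs H)"
      using P.pair_finite_arcs by (auto simp: H_def)
    show "fst e \<in> pverts H" "snd e \<in> pverts H" if "e \<in> parcs H" for e
      using that by (auto simp: H_def path_graph_def)
    show "fst e \<noteq> snd e" if "e \<in> parcs H" for e
      using that parcs_H pair_no_loops by blast
    have "(y, x) \<in> parcs H" if "(x, y) \<in> parcs H" for x y
      using that P.arcs_symmetric by (force simp: H_def)
    then show "symmetric (with_proj H)" by (auto simp: symmetric_def intro: symI)
  qed
  then interpret H: pair_graph H .
  have "subgraph (with_proj H) (with_proj G)"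
    unfolding subgraph_def compatible_def
    using sub parcs_H wf_digraph_axioms H.wf_digraph_axioms by (auto simp: H_def)
  moreover have "graph_iso H (path_graph (length p))"
  proof (rule graph_isoI[OF H pair_graph_path_graph])
    show "bij_betw (nth p) (pverts (path_graph (length p))) (pverts H)"
      using bij by (simp add: H_def path_graph_def)
  qed (rule arc_iff, auto simp: path_graph_def)
  ultimately show ?thesis using H unfolding contains_subgraph_def by blast
qed

section \<open>The extremal graphs: arcs, eigenfunctions and recognition\<close>

lemma S_graph_simps:
  assumes "k \<le> n"
  shows "pverts (S_graph n k) = {0..<n}"
    and "(i, j) \<in> parcs (S_graph n k) \<longleftrightarrow> i < n \<and> j < n \<and> i \<noteq> j \<and> (i < k \<or> j < k)"
  using assms by (auto simp: S_graph_def graph_join_def complete_graph_on_def edgeless_graph_on_def)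

lemma S_plus_graph_simps:
  assumes "k \<le> n"
  shows "pverts (S_plus_graph n k) = {0..<n}"
    and "(i, j) \<in> parcs (S_plus_graph n k)
      \<longleftrightarrow> i < n \<and> j < n \<and> i \<noteq> j \<and> (i < k \<or> j < k) \<or> (i, j) \<in> {(k, k + 1), (k + 1, k)}"
  using S_graph_simps[OF assms] by (auto simp: S_plus_graph_def add_edge_def)

lemma pair_graph_S_graph:
  assumes "k \<le> n"
  shows "pair_graph (S_graph n k)"
proof -
  have "parcs (S_graph n k) \<subseteq> {0..<n} \<times> {0..<n}"
    using S_graph_simps(2)[OF assms] by auto
  then have "finite (parcs (S_graph n k))" by (rule finite_subset) simp
  then show ?thesis
    by unfold_locales (auto simp: S_graph_simps[OF assms] symmetric_def intro!: symI)
qed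

lemma pair_graph_S_plus_graph:
  assumes "k + 2 \<le> n"
  shows "pair_graph (S_plus_graph n k)"
proof -
  have k: "k \<le> n" using assms by simp
  have "parcs (S_plus_graph n k) \<subseteq> {0..<n} \<times> {0..<n}"
    using S_plus_graph_simps(2)[OF k] assms by auto
  then have "finite (parcs (S_plus_graph n k))" by (rule finite_subset) simp
  then show ?thesis
    using assms by unfold_locales (auto simp: S_plus_graph_simps[OF k] symmetric_def intro!: symI)
qed

text \<open>The value 1 on the clique and \<gamma> elsewhere give an eigenfunction: off the clique
  by the choice of \<gamma>, on it by the equation for \<theta>. This lower bound turns q(G) \<ge>
  q(S) into \<theta> \<le> q(G).\<close>

lemma Q_index_S_graph_ge:
  assumes k: "k \<ge> 1" "k \<le> n" and big: "\<theta> > real k"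
    and eq: "\<theta> = 2 * (real k - 1) + (real n - real k) * (1 + real k / (\<theta> - real k))"
  shows "\<theta> \<le> Q_index (S_graph n k)"
proof -
  define S where "S = S_graph n k"
  define \<gamma> where "\<gamma> = real k / (\<theta> - real k)"
  define f where "f i = (if i < k then 1 else \<gamma>)" for i :: nat
  have S: "pair_graph S" unfolding S_def by (rule pair_graph_S_graph[OF k(2)])
  interpret simple_graph "pverts S" "parcs S" by (rule simple_graph_of_pair_graph[OF S])
  note simps = S_graph_simps[OF k(2), folded S_def]
  have split: "{0..<n} = {0..<k} \<union> {k..<n}" using k by auto
  have sum_all: "(\<Sum>i\<in>{0..<n}. f i) = real k + (real n - real k) * \<gamma>"
    unfolding split using k by (subst sum.union_disjoint) (auto simp: f_def of_nat_diff)
  have "Q f i = \<theta> * f i" if i: "i < n" for i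
  proof (cases "i < k")
    case True
    have nbs: "nbs i = {0..<n} - {i}" using True i by (auto simp: nbs_iff simps)
    have "(\<Sum>j\<in>nbs i. f j) = real k + (real n - real k) * \<gamma> - 1"
      using i True unfolding nbs sum_all[symmetric] by (subst sum_diff1) (auto simp: f_def)
    moreover have "real (deg i) = real n - 1" using i unfolding deg_def nbs by (simp add: of_nat_diff)
    ultimately show ?thesis
      using eq True unfolding Q_def \<gamma>_def[symmetric] by (simp add: f_def algebra_simps)
  next
    case False
    have nbs: "nbs i = {0..<k}" using False i k by (auto simp: nbs_iff simps)
    have "Q f i = real k * \<gamma> + real k" using False unfolding Q_def deg_def nbs by (simp add: f_def)
    also have "\<dots> = \<theta> * \<gamma>" using big by (simp add: \<gamma>_def field_simps)
    finally show ?thesis using False by (simp add: f_def)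
  qed
  then show ?thesis
    unfolding S_def[symmetric] using k by (intro Q_index_ge[OF S, of 0 f]) (auto simp: simps f_def)
qed

lemma Q_index_S_plus_graph_ge:
  assumes k: "k \<ge> 1" "k + 2 \<le> n" and big: "\<theta> > real k + 2"
    and eq: "\<theta> = 2 * (real k - 1) + (real n - real k) * (1 + real k / (\<theta> - real k))
      + 2 * (real k / (\<theta> - real k - 2) - real k / (\<theta> - real k))"
  shows "\<theta> \<le> Q_index (S_plus_graph n k)"
proof -
  define S where "S = S_plus_graph n k"
  define \<gamma> \<beta> where "\<gamma> = real k / (\<theta> - real k)" and "\<beta> = real k / (\<theta> - real k - 2)"
  define f where "f i = (if i < k then 1 else if i < k + 2 then \<beta> else \<gamma>)" for i :: nat
  have kn: "k \<le> n" using k by simp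
  have S: "pair_graph S" unfolding S_def by (rule pair_graph_S_plus_graph[OF k(2)])
  interpret simple_graph "pverts S" "parcs S" by (rule simple_graph_of_pair_graph[OF S])
  note simps = S_plus_graph_simps[OF kn, folded S_def]
  have split: "{0..<n} = {0..<k} \<union> ({k, k + 1} \<union> {k + 2..<n})" using k by auto
  have sum_all: "(\<Sum>i\<in>{0..<n}. f i) = real k + (2 * \<beta> + (real n - real k - 2) * \<gamma>)"
  proof -
    have "(\<Sum>i\<in>{0..<k}. f i) = real k" by (simp add: f_def)
    moreover have "(\<Sum>i\<in>{k, k + 1}. f i) = 2 * \<beta>" by (simp add: f_def)
    moreover have "(\<Sum>i\<in>{k + 2..<n}. f i) = (real n - real k - 2) * \<gamma>"
      using k by (simp add: f_def of_nat_diff)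
    moreover have "(\<Sum>i\<in>{0..<n}. f i) = (\<Sum>i\<in>{0..<k}. f i) + (\<Sum>i\<in>{k, k + 1} \<union> {k + 2..<n}. f i)"
      unfolding split by (rule sum.union_disjoint) auto
    moreover have "(\<Sum>i\<in>{k, k + 1} \<union> {k + 2..<n}. f i) = (\<Sum>i\<in>{k, k + 1}. f i) + (\<Sum>i\<in>{k + 2..<n}. f i)"
      by (rule sum.union_disjoint) auto
    ultimately show ?thesis by simp
  qed
  have "Q f i = \<theta> * f i" if i: "i < n" for i
  proof -
    consider "i < k" | "i = k \<or> i = k + 1" | "i \<ge> k + 2" by linarith
    then show ?thesis
    proof cases
      case 1
      have nbs: "nbs i = {0..<n} - {i}" using 1 i by (auto simp: nbs_iff simps)
      have "(\<Sum>j\<in>nbs i. f j) = real k + (2 * \<beta> + (real n - real k - 2) * \<gamma>) - 1"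
        using i 1 unfolding nbs sum_all[symmetric] by (subst sum_diff1) (auto simp: f_def)
      moreover have "real (deg i) = real n - 1" using i unfolding deg_def nbs by (simp add: of_nat_diff)
      ultimately show ?thesis
        using eq 1 unfolding Q_def \<gamma>_def[symmetric] \<beta>_def[symmetric] by (simp add: f_def algebra_simps)
    next
      case 2
      define j where "j = (if i = k then k + 1 else k)"
      have nbs: "nbs i = insert j {0..<k}" using 2 i k by (auto simp: nbs_iff simps j_def)
      have j: "f j = \<beta>" "j \<notin> {0..<k}" by (auto simp: j_def f_def)
      have f: "f i = \<beta>" using 2 by (auto simp: f_def)
      have "Q f i = (real k + 1) * \<beta> + (\<beta> + real k)"
        unfolding Q_def deg_def nbs f using j by (simp add: f_def)
      also have "\<dots> = \<theta> * \<beta>"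
      proof -
        have "(\<theta> - real k - 2) * \<beta> = real k" using big by (simp add: \<beta>_def)
        then show ?thesis by (simp add: algebra_simps)
      qed
      finally show ?thesis using f by simp
    next
      case 3
      have nbs: "nbs i = {0..<k}" using 3 i k by (auto simp: nbs_iff simps)
      have "Q f i = real k * \<gamma> + real k" using 3 unfolding Q_def deg_def nbs by (simp add: f_def)
      also have "\<dots> = \<theta> * \<gamma>" using big by (simp add: \<gamma>_def field_simps)
      finally show ?thesis using 3 by (simp add: f_def)
    qed
  qed
  then show ?thesis
    unfolding S_def[symmetric] using k by (intro Q_index_ge[OF S, of 0 f]) (auto simp: simps f_def)
qed

lemma bij_betw_split:
  assumes "finite V" "X \<subseteq> V" "card V = n" "card X = k"
  obtains \<psi> where "bij_betw \<psi> {0..<n} V" "\<And>i. i < n \<Longrightarrow> \<psi> i \<in> X \<longleftrightarrow> i < k"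
proof -
  have X: "finite X" using assms finite_subset by blast
  have "k \<le> n" using assms card_mono by blast
  have "card (V - X) = n - k" using assms X by (simp add: card_Diff_subset)
  then obtain f g where f: "bij_betw f {0..<k} X" and g: "bij_betw g {k..<n} (V - X)"
    using assms X finite_same_card_bij[of "{0..<k}" X] finite_same_card_bij[of "{k..<n}" "V - X"] by auto
  define \<psi> where "\<psi> i = (if i < k then f i else g i)" for i
  have 1: "bij_betw \<psi> {0..<k} X" using f by (subst bij_betw_cong[of _ \<psi> f]) (auto simp: \<psi>_def)
  have 2: "bij_betw \<psi> {k..<n} (V - X)" using g by (subst bij_betw_cong[of _ \<psi> g]) (auto simp: \<psi>_def)
  have "bij_betw \<psi> ({0..<k} \<union> {k..<n}) (X \<union> (V - X))"
    by (rule bij_betw_combine[OF 1 2]) auto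
  moreover have "{0..<k} \<union> {k..<n} = {0..<n}" using \<open>k \<le> n\<close> by auto
  moreover have "X \<union> (V - X) = V" using assms by auto
  moreover have "\<psi> i \<in> X \<longleftrightarrow> i < k" if "i < n" for i
    using bij_betwE[OF f] bij_betwE[OF g] that by (cases "i < k") (auto simp: \<psi>_def)
  ultimately show ?thesis using that by metis
qed

lemma graph_iso_S_graph:
  assumes G: "pair_graph G" and n: "card (pverts G) = n"
    and X: "X \<subseteq> pverts G" "card X = k"
    and arcs: "\<And>u v. u \<in> pverts G \<Longrightarrow> v \<in> pverts G \<Longrightarrow>
      (u, v) \<in> parcs G \<longleftrightarrow> u \<noteq> v \<and> (u \<in> X \<or> v \<in> X)"
  shows "graph_iso G (S_graph n k)"
proof -
  interpret pair_graph G by fact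
  have k: "k \<le> n" using X n card_mono pair_finite_verts by blast
  obtain \<psi> where \<psi>: "bij_betw \<psi> {0..<n} (pverts G)" "\<And>i. i < n \<Longrightarrow> \<psi> i \<in> X \<longleftrightarrow> i < k"
    using bij_betw_split[OF pair_finite_verts X(1) n X(2)] by blast
  show ?thesis
  proof (rule graph_isoI[OF G pair_graph_S_graph[OF k], of \<psi>])
    show "bij_betw \<psi> (pverts (S_graph n k)) (pverts G)" using \<psi> S_graph_simps[OF k] by simp
    fix i j assume "i \<in> pverts (S_graph n k)" "j \<in> pverts (S_graph n k)"
    then have ij: "i < n" "j < n" using S_graph_simps[OF k] by auto
    then have "\<psi> i \<in> pverts G" "\<psi> j \<in> pverts G" "\<psi> i = \<psi> j \<longleftrightarrow> i = j"
      using \<psi>(1) by (auto simp: bij_betw_def inj_on_eq_iff)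
    then show "(i, j) \<in> parcs (S_graph n k) \<longleftrightarrow> (\<psi> i, \<psi> j) \<in> parcs G"
      using arcs ij \<psi>(2) by (simp add: S_graph_simps[OF k])
  qed
qed

lemma graph_iso_S_plus_graph:
  assumes G: "pair_graph G" and n: "card (pverts G) = n"
    and X: "X \<subseteq> pverts G" "card X = k"
    and ab: "a \<in> pverts G - X" "b \<in> pverts G - X" "a \<noteq> b"
    and arcs: "\<And>u v. u \<in> pverts G \<Longrightarrow> v \<in> pverts G \<Longrightarrow>
      (u, v) \<in> parcs G \<longleftrightarrow> u \<noteq> v \<and> (u \<in> X \<or> v \<in> X) \<or> (u, v) \<in> {(a, b), (b, a)}"
  shows "graph_iso G (S_plus_graph n k)"
proof -
  interpret pair_graph G by fact
  have fin: "finite X" using X finite_subset pair_finite_verts by blast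
  have "card (X \<union> {a, b}) = k + 2" using ab X(2) fin by auto
  moreover have "X \<union> {a, b} \<subseteq> pverts G" using ab X by auto
  ultimately have k2: "k + 2 \<le> n" using n card_mono pair_finite_verts by metis
  then have k: "k \<le> n" by simp
  have "card (pverts G - (X \<union> {a, b})) = card {k + 2..<n}"
    using ab X fin n \<open>card (X \<union> {a, b}) = k + 2\<close> by (subst card_Diff_subset) auto
  then obtain f g where f: "bij_betw f {0..<k} X" and g: "bij_betw g {k + 2..<n} (pverts G - (X \<union> {a, b}))"
    using X fin pair_finite_verts finite_same_card_bij[of "{0..<k}" X]
      finite_same_card_bij[of "{k + 2..<n}" "pverts G - (X \<union> {a, b})"] by auto
  define \<psi> where "\<psi> i = (if i < k then f i else if i = k then a else if i = k + 1 then b else g i)" for i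
  have 1: "bij_betw \<psi> {0..<k} X" using f by (subst bij_betw_cong[of _ \<psi> f]) (auto simp: \<psi>_def)
  have 2: "bij_betw \<psi> {k, k + 1} {a, b}" using ab by (auto simp: \<psi>_def bij_betw_def)
  have 3: "bij_betw \<psi> {k + 2..<n} (pverts G - (X \<union> {a, b}))"
    using g by (subst bij_betw_cong[of _ \<psi> g]) (auto simp: \<psi>_def)
  have "bij_betw \<psi> ({0..<k} \<union> {k, k + 1} \<union> {k + 2..<n}) (X \<union> {a, b} \<union> (pverts G - (X \<union> {a, b})))"
    by (rule bij_betw_combine[OF bij_betw_combine[OF 1 2] 3]) (use ab in auto)
  moreover have "{0..<k} \<union> {k, k + 1} \<union> {k + 2..<n} = {0..<n}" using k2 by auto
  moreover have "X \<union> {a, b} \<union> (pverts G - (X \<union> {a, b})) = pverts G" using ab X by auto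
  ultimately have \<psi>: "bij_betw \<psi> {0..<n} (pverts G)" by metis
  have in_X: "\<psi> i \<in> X \<longleftrightarrow> i < k" if "i < n" for i
    using bij_betwE[OF f] bij_betwE[OF g] ab that by (auto simp: \<psi>_def)
  have is_ab: "\<psi> i = a \<longleftrightarrow> i = k" "\<psi> i = b \<longleftrightarrow> i = k + 1" if "i < n" for i
  proof -
    have "inj_on \<psi> {0..<n}" "i \<in> {0..<n}" "k \<in> {0..<n}" "k + 1 \<in> {0..<n}"
      using \<psi> that k2 by (auto simp: bij_betw_def)
    moreover have "\<psi> k = a" "\<psi> (k + 1) = b" by (simp_all add: \<psi>_def)
    ultimately show "\<psi> i = a \<longleftrightarrow> i = k" "\<psi> i = b \<longleftrightarrow> i = k + 1" by (metis inj_on_eq_iff)+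
  qed
  show ?thesis
  proof (rule graph_isoI[OF G pair_graph_S_plus_graph[OF k2], of \<psi>])
    show "bij_betw \<psi> (pverts (S_plus_graph n k)) (pverts G)" using \<psi> S_plus_graph_simps[OF k] by simp
    fix i j assume "i \<in> pverts (S_plus_graph n k)" "j \<in> pverts (S_plus_graph n k)"
    then have ij: "i < n" "j < n" using S_plus_graph_simps[OF k] by auto
    then have "\<psi> i \<in> pverts G" "\<psi> j \<in> pverts G" "\<psi> i = \<psi> j \<longleftrightarrow> i = j"
      using \<psi> by (auto simp: bij_betw_def inj_on_eq_iff)
    then show "(i, j) \<in> parcs (S_plus_graph n k) \<longleftrightarrow> (\<psi> i, \<psi> j) \<in> parcs G"
      using arcs ij by (simp add: S_plus_graph_simps[OF k] in_X is_ab)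
  qed
qed

theorem theorem4:
  fixes G :: "'a pair_pre_digraph" and n k :: nat
  assumes "k \<ge> 1" and "n \<ge> 7 * k ^ 2"
    and "pair_graph G" and "card (pverts G) = n"
  shows "(Q_index G \<ge> Q_index (S_graph n k) \<longrightarrow>
            contains_subgraph G (path_graph (2 * k + 2)) \<or> graph_iso G (S_graph n k)) \<and>
         (Q_index G \<ge> Q_index (S_plus_graph n k) \<longrightarrow>
            contains_subgraph G (path_graph (2 * k + 3)) \<or> graph_iso G (S_plus_graph n k))"
proof -
  interpret pair_graph G by fact
  interpret simple_graph "pverts G" "parcs G" by (rule simple_graph_of_pair_graph[OF assms(3)])
  have "k ^ 2 \<ge> k" using assms(1) by (simp add: power2_eq_square)
  then have n: "n \<ge> 7 * k" using assms(2) by linarith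
  have k2: "k + 2 \<le> n" and kn: "k \<le> n" "k < n" using n assms(1) by linarith+
  have K: "real k = 1 \<or> real k \<ge> 2" using assms(1) by (cases "k = 1") auto
  have "real n \<ge> real (7 * k ^ 2)" using assms(2) by (rule of_nat_mono)
  then have N: "real n \<ge> 7 * real k * real k" by (simp add: power2_eq_square)
  have ne: "pverts G \<noteq> {}" using assms(1,4) kn by auto
  obtain \<theta>' where \<theta>': "\<theta>' \<ge> real n + 2 * real k - 16 / 7" "real k = 1 \<Longrightarrow> \<theta>' \<ge> real n"
    and eq0: "\<theta>' = 2 * (real k - 1) + (real n - real k) * (1 + real k / (\<theta>' - real k))
      + 0 * (real k / (\<theta>' - real k - 2) - real k / (\<theta>' - real k))"
    using root_exists[OF K N, of 0] by auto
  have eq': "\<theta>' = 2 * (real k - 1) + (real n - real k) * (1 + real k / (\<theta>' - real k))"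
    using eq0 by simp
  obtain \<theta> where \<theta>: "\<theta> \<ge> real n + 2 * real k - 16 / 7" "real k = 1 \<Longrightarrow> \<theta> \<ge> real n"
    and eq: "\<theta> = 2 * (real k - 1) + (real n - real k) * (1 + real k / (\<theta> - real k))
      + 2 * (real k / (\<theta> - real k - 2) - real k / (\<theta> - real k))"
    using root_exists[OF K N, of 2] by auto
  have big: "\<theta>' > real k + 2" "\<theta> > real k + 2"
    using \<theta>'(1) \<theta>(1) n assms(1) by linarith+
  have less: "\<theta>' < \<theta>"
    using assms(1) kn by (intro root_strict_mono[OF _ _ big(2,1) eq' eq]) auto
  \<comment> \<open>Longer paths can be cut, so excluding one path length bounds all lengths; in
    part (i) this also excludes \<open>2 * k + 3\<close>.\<close>
  have contains: "contains_subgraph G (path_graph l)" if "path p" "length p \<ge> l" for p l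
  proof -
    have "length (take l p) = l" using that(2) by simp
    then show ?thesis
      using contains_path_graph[OF assms(3) path_take[OF that(1), of l]] by simp
  qed
  obtain y u where y: "u \<in> pverts G" "y u = 1" "\<And>v. v \<in> pverts G \<Longrightarrow> 0 \<le> y v \<and> y v \<le> 1"
    "\<And>v. v \<in> pverts G \<Longrightarrow> Q_index G * y v \<le> real (deg v) * y v + (\<Sum>w\<in>nbs v. y w)"
    using Q_index_subeigenfunction[OF assms(3) ne] by metis
  \<comment> \<open>The smaller root \<theta>' supplies the lower bounds on the Q-index in both
    parts, since \<theta>' < \<theta>.\<close>
  have sub: "subeigenvector (pverts G) (parcs G) k y (Q_index G) u"
    if "\<And>p. path p \<Longrightarrow> length p \<noteq> 2 * k + 3" "\<theta>' \<le> Q_index G"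
  proof
    show "1 \<le> k" by (rule assms(1))
    show "7 * k\<^sup>2 \<le> card (pverts G)" using assms by simp
    show "real (card (pverts G)) + 2 * real k - 16 / 7 \<le> Q_index G"
      using \<theta>'(1) that(2) assms(4) by simp
    show "real (card (pverts G)) \<le> Q_index G" if "k = 1"
      using \<theta>'(2) \<open>\<theta>' \<le> Q_index G\<close> assms(4) that by simp
  qed (use that y in auto)
  show ?thesis
  proof (intro conjI impI)
    assume "Q_index (S_graph n k) \<le> Q_index G"
    moreover have "\<theta>' \<le> Q_index (S_graph n k)"
      using assms(1) kn big by (intro Q_index_S_graph_ge[OF _ _ _ eq']) auto
    ultimately have le: "\<theta>' \<le> Q_index G" by simp
    show "contains_subgraph G (path_graph (2 * k + 2)) \<or> graph_iso G (S_graph n k)"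
    proof (rule disjCI)
      assume no: "\<not> graph_iso G (S_graph n k)"
      show "contains_subgraph G (path_graph (2 * k + 2))"
      proof (rule ccontr)
        assume "\<not> ?thesis"
        then have np: "\<And>p. path p \<Longrightarrow> length p < 2 * k + 2"
          using contains by (meson not_le)
        then interpret subeigenvector "pverts G" "parcs G" k y "Q_index G" u
          using le by (intro sub) fastforce+
        have "graph_iso G (S_graph n k)"
        proof (rule graph_iso_S_graph[OF assms(3,4) hubs_subset card_hubs])
          note ext = extremal_S[of \<theta>', unfolded assms(4)]
          have "\<And>p. path p \<Longrightarrow> length p \<noteq> 2 * k + 2" using np by fastforce
          note ext = ext[OF this le \<theta>'(1) eq']
          fix v w assume "v \<in> pverts G" "w \<in> pverts G"
          then show "(v, w) \<in> parcs G \<longleftrightarrow> v \<noteq> w \<and> (v \<in> hubs \<or> w \<in> hubs)"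
            using ext(1)[of v] ext(2)[of v] nbs_iff[of w v] by (cases "v \<in> hubs") auto
        qed
        then show False using no by contradiction
      qed
    qed
  next
    assume "Q_index (S_plus_graph n k) \<le> Q_index G"
    moreover have "\<theta> \<le> Q_index (S_plus_graph n k)"
      using assms(1) k2 big by (intro Q_index_S_plus_graph_ge[OF _ _ _ eq]) auto
    ultimately have le: "\<theta> \<le> Q_index G" by simp
    show "contains_subgraph G (path_graph (2 * k + 3)) \<or> graph_iso G (S_plus_graph n k)"
    proof (rule disjCI)
      assume no: "\<not> graph_iso G (S_plus_graph n k)"
      show "contains_subgraph G (path_graph (2 * k + 3))"
      proof (rule ccontr)
        assume "\<not> ?thesis"
        then have np: "\<And>p. path p \<Longrightarrow> length p < 2 * k + 3"
          using contains by (meson not_le)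
        then interpret subeigenvector "pverts G" "parcs G" k y "Q_index G" u
          using le less by (intro sub) fastforce+
        note ext = extremal_S_plus[of \<theta> \<theta>', unfolded assms(4), OF le \<theta>'(1) less eq' eq]
        obtain a b where ab: "a \<in> pverts G - hubs" "b \<in> pverts G - hubs" "a \<noteq> b"
            "nbs a = insert b hubs" "nbs b = insert a hubs"
            "\<forall>v\<in>pverts G - hubs - {a, b}. nbs v = hubs"
          using ext(2) by blast
        have "graph_iso G (S_plus_graph n k)"
        proof (rule graph_iso_S_plus_graph[OF assms(3,4) hubs_subset card_hubs ab(1-3)])
          fix v w assume vw: "v \<in> pverts G" "w \<in> pverts G"
          consider "v \<in> hubs" | "v = a" | "v = b" | "v \<in> pverts G - hubs - {a, b}"
            using vw by blast
          then show "(v, w) \<in> parcs G \<longleftrightarrow> v \<noteq> w \<and> (v \<in> hubs \<or> w \<in> hubs) \<or> (v, w) \<in> {(a, b), (b, a)}"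
            unfolding nbs_iff[symmetric] using vw ab ext(1)[of v] by cases auto
        qed
        then show False using no by contradiction
      qed
    qed
  qed
qed

end
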